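(* Let $\mathbb{F}$ be a non-abelian free group. Then: (1) $\mathcal{PO}_C(\mathbb{F})$ has no isolated elements for each finitely generated left-relatively convex subgroup $C$ on $\mathbb{F}$. In particular, if $\mathbb{F}$ has at most countable free rank, then $\mathcal{PO}_C(\mathbb{F})$ is (homeomorphic to) a Cantor set for each such $C$. (2) $\mathcal{PO}(\mathbb{F})$ has no isolated elements. In particular, if $\mathbb{F}$ has finite free rank, then $\mathcal{PO}(\mathbb{F})$ is (homeomorphic to) a Cantor set.
   Context: A left-preorder on a group $\Gamma$ is a total, transitive, reflexive binary relation $\preceq$ on $\Gamma$ that is left-invariant ($g_1\preceq g_2$ implies $gg_1\preceq gg_2$) and non-trivial (not all pairs are related). For a left-preorder $\preceq$, the set $C=\{g: g\preceq 1 \text{ and } 1\preceq g\}$ is a proper subgroup of $\Gamma$, and $\preceq$ is said to be a left-preorder on $\Gamma$ relative to $C$; the positive cone is $P=\{g\in\Gamma: 1\preceq g,\ g\notin C\}$, and $\Gamma=P\sqcup P^{-1}\sqcup C$. A proper subgroup $C$ of $\Gamma$ is left-relatively convex on $\Gamma$ if there exists a left-preorder on $\Gamma$ relative to $C$. Each left-preorder is identified with the map $\phi_\preceq:\Gamma\to\{\pm1,0\}$ equal to $1$ on $P$, $-1$ on $P^{-1}$ and $0$ on $C$. $\mathcal{PO}(\Gamma)$ is the set of all left-preorders on $\Gamma$ and $\mathcal{PO}_C(\Gamma)$ the set of those relative to $C$, both endowed with the subspace topology from $\{\pm1,0\}^\Gamma$ (discrete topology on $\{\pm1,0\}$, product topology).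 *)

theory Defs
  imports "HOL-Analysis.Analysis" "HOL-Algebra.Generated_Groups"
begin

section \<open>Free groups\<close>

text \<open>A letter \<open>(True, s)\<close> stands for \<open>s\<close>, a letter \<open>(False, s)\<close> for the inverse of \<open>s\<close>.\<close>

definition letter_value :: "('a, 'b) monoid_scheme \<Rightarrow> bool \<times> 'a \<Rightarrow> 'a"
  where "letter_value G l = (if fst l then snd l else inv\<^bsub>G\<^esub> (snd l))"

definition word_value :: "('a, 'b) monoid_scheme \<Rightarrow> (bool \<times> 'a) list \<Rightarrow> 'a"
  where "word_value G w = foldr (\<lambda>l x. letter_value G l \<otimes>\<^bsub>G\<^esub> x) w \<one>\<^bsub>G\<^esub>"

definition reduced_words :: "'a set \<Rightarrow> (bool \<times> 'a) list set"
  where "reduced_words S = {w. snd ` set w \<subseteq> S \<and>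
           successively (\<lambda>l m. \<not> (snd l = snd m \<and> fst l \<noteq> fst m)) w}"

text \<open>\<open>S\<close> is a free basis if every group element is the value of exactly one reduced word
  over \<open>S\<close>. The free rank is the cardinality of a free basis, which is the same for all bases.\<close>

definition free_basis :: "('a, 'b) monoid_scheme \<Rightarrow> 'a set \<Rightarrow> bool"
  where "free_basis G S \<longleftrightarrow> S \<subseteq> carrier G \<and>
           bij_betw (word_value G) (reduced_words S) (carrier G)"

definition free_group :: "('a, 'b) monoid_scheme \<Rightarrow> bool"
  where "free_group G \<longleftrightarrow> group G \<and> (\<exists>S. free_basis G S)"

definition countable_free_rank :: "('a, 'b) monoid_scheme \<Rightarrow> bool"
  where "countable_free_rank G \<longleftrightarrow> (\<exists>S. free_basis G S \<and> countable S)"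

definition finite_free_rank :: "('a, 'b) monoid_scheme \<Rightarrow> bool"
  where "finite_free_rank G \<longleftrightarrow> (\<exists>S. free_basis G S \<and> finite S)"

definition finitely_generated_subgroup :: "'a set \<Rightarrow> ('a, 'b) monoid_scheme \<Rightarrow> bool"
  where "finitely_generated_subgroup C G \<longleftrightarrow>
           subgroup C G \<and> (\<exists>S. finite S \<and> S \<subseteq> carrier G \<and> C = generate G S)"


section \<open>Left-preorders\<close>

text \<open>\<open>(x, y) \<in> r\<close> means that \<open>x\<close> precedes \<open>y\<close>. Reflexivity is a separate conjunct because
  \<^const>\<open>total_on\<close> only concerns distinct elements.\<close>

definition left_preorder :: "('a, 'b) monoid_scheme \<Rightarrow> ('a \<times> 'a) set \<Rightarrow> bool"
  where "left_preorder G r \<longleftrightarrow>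
           r \<subseteq> carrier G \<times> carrier G \<and>
           total_on (carrier G) r \<and> trans r \<and> refl_on (carrier G) r \<and>
           (\<forall>g\<in>carrier G. \<forall>x\<in>carrier G. \<forall>y\<in>carrier G.
              (x, y) \<in> r \<longrightarrow> (g \<otimes>\<^bsub>G\<^esub> x, g \<otimes>\<^bsub>G\<^esub> y) \<in> r) \<and>
           r \<noteq> carrier G \<times> carrier G"

definition preorder_kernel :: "('a, 'b) monoid_scheme \<Rightarrow> ('a \<times> 'a) set \<Rightarrow> 'a set"
  where "preorder_kernel G r = {g \<in> carrier G. (g, \<one>\<^bsub>G\<^esub>) \<in> r \<and> (\<one>\<^bsub>G\<^esub>, g) \<in> r}"

definition positive_cone :: "('a, 'b) monoid_scheme \<Rightarrow> ('a \<times> 'a) set \<Rightarrow> 'a set"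
  where "positive_cone G r = {g \<in> carrier G. (\<one>\<^bsub>G\<^esub>, g) \<in> r \<and> g \<notin> preorder_kernel G r}"

definition left_preorder_relative_to ::
    "('a, 'b) monoid_scheme \<Rightarrow> 'a set \<Rightarrow> ('a \<times> 'a) set \<Rightarrow> bool"
  where "left_preorder_relative_to G C r \<longleftrightarrow> left_preorder G r \<and> preorder_kernel G r = C"

definition left_relatively_convex :: "('a, 'b) monoid_scheme \<Rightarrow> 'a set \<Rightarrow> bool"
  where "left_relatively_convex G C \<longleftrightarrow>
           subgroup C G \<and> C \<noteq> carrier G \<and> (\<exists>r. left_preorder_relative_to G C r)"


section \<open>Spaces of left-preorders\<close>

definition preorder_map :: "('a, 'b) monoid_scheme \<Rightarrow> ('a \<times> 'a) set \<Rightarrow> 'a \<Rightarrow> int"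
  where "preorder_map G r = (\<lambda>g\<in>carrier G.
           if g \<in> positive_cone G r then 1
           else if inv\<^bsub>G\<^esub> g \<in> positive_cone G r then - 1
           else 0)"

definition sign_topology :: "('a, 'b) monoid_scheme \<Rightarrow> ('a \<Rightarrow> int) topology"
  where "sign_topology G = product_topology (\<lambda>_. discrete_topology {1, - 1, 0}) (carrier G)"

definition PO :: "('a, 'b) monoid_scheme \<Rightarrow> ('a \<Rightarrow> int) topology"
  where "PO G = subtopology (sign_topology G) (preorder_map G ` {r. left_preorder G r})"

definition PO_rel :: "('a, 'b) monoid_scheme \<Rightarrow> 'a set \<Rightarrow> ('a \<Rightarrow> int) topology"
  where "PO_rel G C =
           subtopology (sign_topology G) (preorder_map G ` {r. left_preorder_relative_to G C r})"

definition no_isolated_elements :: "'a topology \<Rightarrow> bool"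
  where "no_isolated_elements T \<longleftrightarrow> \<not> (\<exists>x\<in>topspace T. openin T {x})"


section \<open>The Cantor set\<close>

text \<open>The middle-thirds Cantor set.\<close>

primrec cantor_stage :: "nat \<Rightarrow> real set"
  where
    "cantor_stage 0 = {0..1}"
  | "cantor_stage (Suc n) = (\<lambda>x. x / 3) ` cantor_stage n \<union> (\<lambda>x. (2 + x) / 3) ` cantor_stage n"

definition cantor_set :: "real set"
  where "cantor_set = (\<Inter>n. cantor_stage n)"

definition is_cantor_set :: "'a topology \<Rightarrow> bool"
  where "is_cantor_set T \<longleftrightarrow> T homeomorphic_space (top_of_set cantor_set)"

end

theory Submission
  imports Defs
begin

text \<open>A left-preorder is the order on the orbit of a point under an action by order automorphisms of
  a line. On a finite connected part \<open>W\<close> of the Cayley graph of a free group, the order is realised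
  in \<open>\<real>\<close>, and each generator may be extended independently from its finite partial graph to an
  increasing bijection of \<open>\<real>\<close>. As the action is non-trivial, some letter moves the largest point
  of \<open>W\<close> to a larger point \<open>v\<close>; a second generator \<open>t\<close> can then move \<open>v\<close> up or down, which gives
  two different left-preorders that agree with the given one on \<open>W\<close>. If the kernel \<open>C\<close> is generated
  by elements of \<open>W\<close>, the new kernel contains \<open>C\<close>, and a lexicographic refinement by the old
  left-preorder makes it equal to \<open>C\<close>. The Cantor set statements follow from Brouwer's
  characterisation: in a compact space without isolated points, repeatedly splitting along the first
  possible member of a separating sequence of clopen sets codes the points by binary sequences.\<close>

section \<open>Brouwer's characterisation of the Cantor set\<close>

definition ternary_sum :: "(nat \<Rightarrow> bool) \<Rightarrow> real"
  where "ternary_sum \<beta> = (\<Sum>k. (if \<beta> k then 2 else 0) / 3 ^ Suc k)"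

text \<open>The expansion with all digits 2 is the majorant behind summability and the upper bound
  1.\<close>

lemma sums_two_thirds: "(\<lambda>k. 2 / 3 ^ Suc k :: real) sums 1"
proof -
  have "(\<lambda>k. (2/3) * (1/3::real) ^ k) sums ((2/3) * (1 / (1 - 1/3)))"
    by (intro sums_mult geometric_sums) auto
  then show ?thesis
    by (simp add: power_one_over divide_simps)
qed

lemma summable_ternary: "summable (\<lambda>k. (if \<beta> k then 2 else 0) / 3 ^ Suc k :: real)"
  by (rule summable_comparison_test'[OF sums_summable[OF sums_two_thirds], of 0]) auto

lemma ternary_sum_nonneg: "0 \<le> ternary_sum \<beta>"
  unfolding ternary_sum_def by (intro suminf_nonneg summable_ternary) auto

lemma ternary_sum_le_1: "ternary_sum \<beta> \<le> 1"
proof -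
  have "ternary_sum \<beta> \<le> (\<Sum>k. 2 / 3 ^ Suc k)"
    unfolding ternary_sum_def
    by (intro suminf_le summable_ternary sums_summable[OF sums_two_thirds]) auto
  then show ?thesis
    using sums_unique[OF sums_two_thirds] by simp
qed

text \<open>This is the self-similarity of the Cantor set: the first digit selects one of the two
  contractions in \<open>cantor_stage\<close>, and the shifted sequence supplies its argument. The
  inductions below unfold it once per digit.\<close>

lemma ternary_sum_rec:
  "ternary_sum \<beta> = ((if \<beta> 0 then 2 else 0) + ternary_sum (\<lambda>k. \<beta> (Suc k))) / 3"
proof -
  have "ternary_sum \<beta> =
      (\<Sum>k. (if \<beta> (Suc k) then 2 else 0) / 3 ^ Suc (Suc k)) + (if \<beta> 0 then 2 else 0) / 3"
    unfolding ternary_sum_def using suminf_split_head[OF summable_ternary[of \<beta>]] by simp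
  also have "(\<Sum>k. (if \<beta> (Suc k) then 2 else 0) / 3 ^ Suc (Suc k)) =
      (\<Sum>k. (1/3) * ((if \<beta> (Suc k) then 2 else 0) / 3 ^ Suc k) :: real)"
    by (rule suminf_cong) auto
  also have "\<dots> = (1/3) * ternary_sum (\<lambda>k. \<beta> (Suc k))"
    unfolding ternary_sum_def by (rule suminf_mult[OF summable_ternary])
  finally show ?thesis by (simp add: add_divide_distrib)
qed

lemma ternary_sum_prefix:
  assumes "\<And>k. k < n \<Longrightarrow> \<beta> k = \<gamma> k"
  shows "\<bar>ternary_sum \<beta> - ternary_sum \<gamma>\<bar> \<le> 1 / 3 ^ n"
  using assms
proof (induction n arbitrary: \<beta> \<gamma>)
  case 0
  then show ?case
    using ternary_sum_nonneg[of \<beta>] ternary_sum_nonneg[of \<gamma>]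
      ternary_sum_le_1[of \<beta>] ternary_sum_le_1[of \<gamma>] by simp
next
  case (Suc n)
  have "\<bar>ternary_sum (\<lambda>k. \<beta> (Suc k)) - ternary_sum (\<lambda>k. \<gamma> (Suc k))\<bar> \<le> 1 / 3 ^ n"
    by (rule Suc.IH) (use Suc.prems in auto)
  moreover have "\<beta> 0 = \<gamma> 0" using Suc.prems by simp
  ultimately show ?case
    by (subst (1 2) ternary_sum_rec) (auto simp: abs_if field_simps split: if_splits)
qed

text \<open>First digit 0 forces a value of at most 1/3 and first digit 2 a value of at least 2/3.
  The value therefore determines the first digit, and then the value of the tail.\<close>

lemma inj_ternary_sum: "inj ternary_sum"
proof -
  have "\<beta> n = \<gamma> n" if "ternary_sum \<beta> = ternary_sum \<gamma>" for n \<beta> \<gamma>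
    using that
  proof (induction n arbitrary: \<beta> \<gamma>)
    case 0
    then show ?case
      using ternary_sum_rec[of \<beta>] ternary_sum_rec[of \<gamma>]
        ternary_sum_nonneg[of "\<lambda>k. \<beta> (Suc k)"] ternary_sum_nonneg[of "\<lambda>k. \<gamma> (Suc k)"]
        ternary_sum_le_1[of "\<lambda>k. \<beta> (Suc k)"] ternary_sum_le_1[of "\<lambda>k. \<gamma> (Suc k)"]
      by (auto split: if_splits)
  next
    case (Suc n)
    then have "ternary_sum (\<lambda>k. \<beta> (Suc k)) = ternary_sum (\<lambda>k. \<gamma> (Suc k))"
      using ternary_sum_rec[of \<beta>] ternary_sum_rec[of \<gamma>]
        ternary_sum_nonneg[of "\<lambda>k. \<beta> (Suc k)"] ternary_sum_nonneg[of "\<lambda>k. \<gamma> (Suc k)"]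
        ternary_sum_le_1[of "\<lambda>k. \<beta> (Suc k)"] ternary_sum_le_1[of "\<lambda>k. \<gamma> (Suc k)"]
      by (auto split: if_splits)
    then show ?case using Suc.IH by blast
  qed
  then show ?thesis by (auto intro!: injI)
qed

lemma cantor_stage_bounds: "cantor_stage n \<subseteq> {0..1}"
  by (induction n) (auto simp: image_subset_iff subset_iff)

lemma ternary_sum_in_stage: "ternary_sum \<beta> \<in> cantor_stage n"
proof (induction n arbitrary: \<beta>)
  case 0
  then show ?case by (simp add: ternary_sum_nonneg ternary_sum_le_1)
next
  case (Suc n)
  show ?case
    by (subst ternary_sum_rec) (use Suc.IH in auto)
qed

lemma range_ternary_sum: "range ternary_sum = cantor_set"
proof
  show "range ternary_sum \<subseteq> cantor_set"
    by (auto simp: cantor_set_def ternary_sum_in_stage)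
  show "cantor_set \<subseteq> range ternary_sum"
  proof
    fix x assume x: "x \<in> cantor_set"
    \<comment> \<open>\<open>T\<close> undoes the two contractions. The threshold 1/2 lies in the
      removed middle third, so on the Cantor set it detects the right branch. The digits of
      \<open>x\<close> are its itinerary under \<open>T\<close>, and each step divides the error by
      3.\<close>
    define T where "T x = (if x \<le> 1/2 then 3 * x else 3 * x - 2)" for x :: real
    have T: "T y \<in> cantor_set" if "y \<in> cantor_set" for y
    proof -
      have "T y \<in> cantor_stage n" for n
      proof -
        have "y \<in> cantor_stage (Suc n)" using that by (simp add: cantor_set_def del: cantor_stage.simps)
        then obtain z where z: "z \<in> cantor_stage n" "y = z / 3 \<or> y = (2 + z) / 3"
          by auto
        then have "0 \<le> z" "z \<le> 1" using cantor_stage_bounds[of n] by auto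
        then have "T y = z" using z(2) by (auto simp: T_def)
        then show ?thesis using z(1) by simp
      qed
      then show ?thesis by (simp add: cantor_set_def)
    qed
    have approx: "\<bar>y - ternary_sum (\<lambda>k. (T ^^ k) y > 1/2)\<bar> \<le> 1 / 3 ^ n" if "y \<in> cantor_set" for y n
      using that
    proof (induction n arbitrary: y)
      case 0
      then have "y \<in> cantor_stage 0" by (auto simp: cantor_set_def simp del: cantor_stage.simps)
      then show ?case
        using ternary_sum_nonneg[of "\<lambda>k. (T ^^ k) y > 1/2"]
          ternary_sum_le_1[of "\<lambda>k. (T ^^ k) y > 1/2"]
        by (auto simp: abs_le_iff)
    next
      case (Suc n)
      define z where "z = ternary_sum (\<lambda>k. (T ^^ Suc k) y > 1/2)"
      have bound: "\<bar>T y - z\<bar> \<le> 1 / 3 ^ n"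
        using Suc.IH[OF T[OF Suc.prems]] by (simp add: z_def funpow_Suc_right del: funpow.simps)
      have "ternary_sum (\<lambda>k. (T ^^ k) y > 1/2) = ((if y > 1/2 then 2 else 0) + z) / 3"
        unfolding z_def by (subst ternary_sum_rec) simp
      then have "y - ternary_sum (\<lambda>k. (T ^^ k) y > 1/2) = (T y - z) / 3"
        by (auto simp: T_def)
      with bound show ?case by (simp add: abs_divide)
    qed
    have "x = ternary_sum (\<lambda>k. (T ^^ k) x > 1/2)"
    proof (rule ccontr)
      assume "x \<noteq> ternary_sum (\<lambda>k. (T ^^ k) x > 1/2)"
      then have "\<bar>x - ternary_sum (\<lambda>k. (T ^^ k) x > 1/2)\<bar> > 0" by simp
      then obtain n where "(1/3) ^ n < \<bar>x - ternary_sum (\<lambda>k. (T ^^ k) x > 1/2)\<bar>"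
        using real_arch_pow_inv[of _ "1/3"] by force
      then show False using approx[OF x, of n] by (simp add: power_one_over)
    qed
    then show "x \<in> range ternary_sum" by blast
  qed
qed

section \<open>Coding a compact space by successive clopen splittings\<close>

text \<open>The splittings form a full binary tree of nonempty clopen sets. Compactness puts a point
  on every branch; always splitting along the earliest possible set leaves only one point
  there.\<close>

lemma clopen_separated_imp_cantor_set:
  fixes T :: "'a topology" and U :: "nat \<Rightarrow> 'a set"
  assumes comp: "compact_space T" and ne: "topspace T \<noteq> {}"
    and perfect: "no_isolated_elements T"
    and opn: "\<And>n. openin T (U n)" and cls: "\<And>n. closedin T (U n)"
    and sep: "\<And>x y. x \<in> topspace T \<Longrightarrow> y \<in> topspace T \<Longrightarrow> x \<noteq> y \<Longrightarrow> \<exists>n. (x \<in> U n) \<noteq> (y \<in> U n)"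
  shows "is_cantor_set T"
proof -
  \<comment> \<open>For an \<open>A\<close> that no member of the sequence cuts, the
    \<open>LEAST\<close> is arbitrary. The fact \<open>splits\<close> excludes this for nonempty
    open \<open>A\<close>: such a set is not a singleton, and two of its points are separated by
    some \<open>U n\<close>.\<close>
  define V where "V A = U (LEAST n. A \<inter> U n \<noteq> {} \<and> A - U n \<noteq> {})" for A
  define node where "node \<beta> = rec_nat (topspace T) (\<lambda>k A. if \<beta> k then A \<inter> V A else A - V A)"
    for \<beta> :: "nat \<Rightarrow> bool"
  have node_0: "node \<beta> 0 = topspace T"
    and node_Suc: "node \<beta> (Suc k) = (if \<beta> k then node \<beta> k \<inter> V (node \<beta> k) else node \<beta> k - V (node \<beta> k))"
    for \<beta> k by (simp_all add: node_def)
  have splits: "A \<inter> V A \<noteq> {} \<and> A - V A \<noteq> {}" if A: "openin T A" "A \<noteq> {}" for A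
  proof -
    obtain x where x: "x \<in> A" using A by blast
    have "A \<noteq> {x}"
      using perfect A x openin_subset unfolding no_isolated_elements_def by blast
    then obtain y where y: "y \<in> A" "y \<noteq> x" using x by blast
    then obtain n where "(x \<in> U n) \<noteq> (y \<in> U n)"
      using sep A x openin_subset by (metis subsetD)
    then have "A \<inter> U n \<noteq> {} \<and> A - U n \<noteq> {}" using x y by blast
    then show ?thesis unfolding V_def by (rule LeastI)
  qed
  have V_clopen: "openin T (V A)" "closedin T (V A)" for A
    by (simp_all add: V_def opn cls)
  have node: "openin T (node \<beta> k) \<and> closedin T (node \<beta> k) \<and> node \<beta> k \<noteq> {}" for \<beta> k
  proof (induction k)
    case 0
    then show ?case using ne by (simp add: node_0 del: null_topspace_iff_trivial)
  next
    case (Suc k)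
    then show ?case
      using splits[of "node \<beta> k"] V_clopen[of "node \<beta> k"]
      by (auto simp: node_Suc intro: openin_diff closedin_diff)
  qed
  have node_decseq: "decseq (node \<beta>)" for \<beta>
    by (rule decseq_SucI) (auto simp: node_Suc)
  \<comment> \<open>While \<open>node\<close> follows a given binary sequence, \<open>cell\<close>
    follows a given point, and \<open>code\<close> records the turns taken. The fact
    \<open>cell_node\<close> reconciles the two descriptions.\<close>
  define cell where "cell x = rec_nat (topspace T) (\<lambda>k A. {y \<in> A. y \<in> V A \<longleftrightarrow> x \<in> V A})" for x
  define code where "code x k = (x \<in> V (cell x k))" for x k
  have cell_0: "cell x 0 = topspace T"
    and cell_Suc: "cell x (Suc k) = {y \<in> cell x k. y \<in> V (cell x k) \<longleftrightarrow> x \<in> V (cell x k)}" for x k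
    by (simp_all add: cell_def)
  have cell_node: "cell x k = node (code x) k" for x k
    by (induction k) (auto simp: cell_0 cell_Suc node_0 node_Suc code_def)
  have in_cell: "x \<in> cell x k" if "x \<in> topspace T" for x k
    using that by (induction k) (auto simp: cell_0 cell_Suc)
  have same_code: "code y j = code x j" if "y \<in> cell x k" "j < k" for x y j k
  proof -
    have "cell y i = cell x i" if "i \<le> k" for i
      using that
    proof (induction i)
      case (Suc i)
      have "y \<in> cell x (Suc i)"
        using \<open>y \<in> cell x k\<close> Suc.prems node_decseq[of "code x"] unfolding cell_node decseq_def by blast
      with Suc show ?case by (auto simp: cell_Suc)
    qed (simp add: cell_0)
    moreover have "y \<in> cell x (Suc j)"
      using that node_decseq[of "code x"] unfolding cell_node decseq_def by (meson Suc_leI subsetD)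
    ultimately show ?thesis using that by (simp add: code_def cell_Suc)
  qed
  have inj: "inj_on code (topspace T)"
  proof (rule inj_onI, rule ccontr)
    fix x y assume x: "x \<in> topspace T" and y: "y \<in> topspace T" and eq: "code x = code y" and "x \<noteq> y"
    then obtain m where m: "(x \<in> U m) \<noteq> (y \<in> U m)" using sep by blast
    define A where "A = node (code x)"
    have xy: "x \<in> A k" "y \<in> A k" for k
      using in_cell[OF x, of k] in_cell[OF y, of k] by (simp_all add: cell_node A_def eq)
    \<comment> \<open>Both points lie in every node of the branch, so \<open>U m\<close> cuts every
      node and bounds all the least indices. A later node lies on one side of each earlier splitting
      set, so these indices are pairwise distinct: infinitely many naturals would be at most
      \<open>m\<close>.\<close>
    define n where "n k = (LEAST n. A k \<inter> U n \<noteq> {} \<and> A k - U n \<noteq> {})" for k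
    have "n k \<le> m" for k
      unfolding n_def by (rule Least_le) (use xy m in blast)
    moreover have "inj n"
    proof (rule linorder_injI)
      fix j k :: nat assume "j < k"
      then have "A k \<subseteq> A (Suc j)"
        using node_decseq[of "code x"] by (simp add: A_def decseq_def Suc_leI)
      moreover have "A (Suc j) \<subseteq> V (A j) \<or> A (Suc j) \<inter> V (A j) = {}"
        by (auto simp: A_def node_Suc)
      moreover have "A k \<inter> V (A k) \<noteq> {} \<and> A k - V (A k) \<noteq> {}"
        using splits node by (simp add: A_def)
      ultimately have "V (A j) \<noteq> V (A k)" by blast
      then show "n j \<noteq> n k" by (auto simp: V_def n_def)
    qed
    ultimately have "finite (UNIV :: nat set)"
      by (intro inj_on_finite[of n UNIV "{..m}"]) auto
    then show False by simp
  qed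
  have surj: "\<exists>x\<in>topspace T. code x = \<beta>" for \<beta>
  proof -
    have "(\<Inter>k. node \<beta> k) \<noteq> {}"
      by (rule compact_space_imp_nest[OF comp]) (use node node_decseq in auto)
    then obtain x where x: "\<And>k. x \<in> node \<beta> k" by blast
    have "cell x k = node \<beta> k \<and> (code x k = \<beta> k)" for k
    proof (induction k)
      case 0
      then show ?case using x[of "Suc 0"] by (auto simp: cell_0 node_0 node_Suc code_def split: if_splits)
    next
      case (Suc k)
      then have eq: "cell x (Suc k) = node \<beta> (Suc k)"
        by (auto simp: cell_node node_Suc)
      then show ?case using x[of "Suc (Suc k)"]
        by (subst code_def, subst (asm) node_Suc) (auto split: if_splits)
    qed
    moreover have "x \<in> topspace T" using x[of 0] by (simp add: node_0)
    ultimately show ?thesis by blast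
  qed
  define f where "f x = ternary_sum (code x)" for x
  have "homeomorphic_map T (top_of_set cantor_set) f"
  \<comment> \<open>A continuous bijection from a compact space onto a Hausdorff space is a
    homeomorphism, so only continuity and bijectivity remain.\<close>
  proof (rule continuous_imp_homeomorphic_map)
    show image: "f ` topspace T = topspace (top_of_set cantor_set)"
      using surj range_ternary_sum by (auto simp: f_def image_iff) (metis rangeE)
    show "inj_on f (topspace T)"
      using inj inj_ternary_sum by (auto simp: f_def inj_on_def)
    have "continuous_map T euclideanreal f"
      unfolding continuous_map_def
    proof safe
      fix W assume W: "openin euclideanreal W"
      show "openin T {x \<in> topspace T. f x \<in> W}"
      proof (subst openin_subopen, safe)
        fix x assume x: "x \<in> topspace T" "f x \<in> W"
        then obtain e where e: "e > 0" "\<And>z. \<bar>z - f x\<bar> < e \<Longrightarrow> z \<in> W"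
          using W by (auto simp: open_real)
        obtain k where k: "(1/3::real) ^ k < e" using real_arch_pow_inv[OF e(1), of "1/3"] by auto
        \<comment> \<open>On the open set \<open>cell x k\<close> the first \<open>k\<close> code
          digits agree with those of \<open>x\<close>, which confines \<open>f\<close> to within
          \<open>1 / 3 ^ k\<close> of \<open>f x\<close>.\<close>
        have "f y \<in> W" if "y \<in> cell x k" for y
          using ternary_sum_prefix[of k "code y" "code x"] same_code[OF that] k
          by (intro e(2)) (auto simp: f_def power_one_over)
        moreover have "cell x k \<subseteq> topspace T"
          using node openin_subset by (metis cell_node)
        ultimately show "\<exists>O'. openin T O' \<and> x \<in> O' \<and> O' \<subseteq> {x \<in> topspace T. f x \<in> W}"
          using node in_cell[OF x(1)] by (intro exI[of _ "cell x k"]) (auto simp: cell_node)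
      qed
    qed auto
    then show "continuous_map T (top_of_set cantor_set) f"
      using image by (auto simp: continuous_map_in_subtopology)
  qed (use comp in \<open>auto intro: Hausdorff_space_subtopology Hausdorff_space_euclidean\<close>)
  then show ?thesis
    unfolding is_cantor_set_def by (rule homeomorphic_map_imp_homeomorphic_space)
qed

section \<open>Actions of free groups\<close>

lemma word_value_simps [simp]:
  "word_value G [] = \<one>\<^bsub>G\<^esub>"
  "word_value G (l # w) = letter_value G l \<otimes>\<^bsub>G\<^esub> word_value G w"
  by (simp_all add: word_value_def)

context group
begin

lemma letter_value_closed: "snd l \<in> carrier G \<Longrightarrow> letter_value G l \<in> carrier G"
  by (simp add: letter_value_def)

lemma word_value_closed: "snd ` set w \<subseteq> carrier G \<Longrightarrow> word_value G w \<in> carrier G"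
  by (induction w) (auto simp: letter_value_closed)

lemma free_basis_word:
  assumes "free_basis G S" "g \<in> carrier G"
  obtains w where "w \<in> reduced_words S" "word_value G w = g"
  using assms unfolding free_basis_def bij_betw_def by (metis imageE)

text \<open>Letters are peeled off on the left, which matches the Cayley graph edges from
  \<open>x\<close> to \<open>s \<otimes> x\<close>. The induction runs over arbitrary words, so no
  step has to preserve reducedness.\<close>

lemma free_basis_induct [consumes 2, case_names one letter inv_letter]:
  assumes basis: "free_basis G S" and g: "g \<in> carrier G"
    and "P \<one>"
    and step: "\<And>s x. s \<in> S \<Longrightarrow> x \<in> carrier G \<Longrightarrow> P x \<Longrightarrow> P (s \<otimes> x)"
    and step': "\<And>s x. s \<in> S \<Longrightarrow> x \<in> carrier G \<Longrightarrow> P x \<Longrightarrow> P (inv s \<otimes> x)"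
  shows "P g"
proof -
  obtain w where w: "w \<in> reduced_words S" "word_value G w = g"
    using free_basis_word[OF basis g] .
  have S: "S \<subseteq> carrier G" using basis by (simp add: free_basis_def)
  have "P (word_value G w)" if "snd ` set w \<subseteq> S" for w
    using that
  proof (induction w)
    case (Cons l w)
    then have "word_value G w \<in> carrier G" using S by (intro word_value_closed) auto
    then show ?case using Cons step step' by (cases l) (auto simp: letter_value_def)
  qed (simp add: assms)
  then show ?thesis using w by (auto simp: reduced_words_def)
qed

text \<open>This is the universal property of the free group for actions by bijections. The action
  is read off the unique reduced word; multiplicativity is proved first for a single letter on the
  left and then by induction.\<close>

lemma free_basis_action:
  fixes f :: "'a \<Rightarrow> 'c \<Rightarrow> 'c"
  assumes basis: "free_basis G S" and f: "\<And>s. s \<in> S \<Longrightarrow> bij (f s)"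
  obtains \<rho> where "\<rho> \<one> = id"
    and "\<And>g h. g \<in> carrier G \<Longrightarrow> h \<in> carrier G \<Longrightarrow> \<rho> (g \<otimes> h) = \<rho> g \<circ> \<rho> h"
    and "\<And>s. s \<in> S \<Longrightarrow> \<rho> s = f s"
proof -
  have S: "S \<subseteq> carrier G" using basis by (simp add: free_basis_def)
  have bij: "bij_betw (word_value G) (reduced_words S) (carrier G)"
    using basis by (simp add: free_basis_def)
  define act where "act l = (if fst l then f (snd l) else inv_into UNIV (f (snd l)))" for l
  define word_act where "word_act w = foldr (\<lambda>l h. act l \<circ> h) w id" for w
  define \<rho> where "\<rho> g = word_act (the_inv_into (reduced_words S) (word_value G) g)" for g
  have word_act_simps: "word_act [] = id" "word_act (l # w) = act l \<circ> word_act w" for l w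
    by (simp_all add: word_act_def)
  have \<rho>_word: "\<rho> (word_value G w) = word_act w" if "w \<in> reduced_words S" for w
    using bij that by (simp add: \<rho>_def bij_betw_def the_inv_into_f_f)
  have cancel: "act (\<not> b, s) \<circ> act (b, s) = id" if "s \<in> S" for b s
    using f[OF that] by (cases b) (simp_all add: act_def bij_is_inj bij_is_surj flip: surj_iff)
  have \<rho>_letter: "\<rho> (letter_value G l \<otimes> g) = act l \<circ> \<rho> g"
    if l: "snd l \<in> S" and g: "g \<in> carrier G" for l g
  proof -
    obtain w where w: "w \<in> reduced_words S" "word_value G w = g"
      using free_basis_word[OF basis g] .
    show ?thesis
    proof (cases "l # w \<in> reduced_words S")
      case True
      then show ?thesis using \<rho>_word[OF True] \<rho>_word[OF w(1)] w(2) by (simp add: word_act_simps)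
    next
      case False
      \<comment> \<open>Since \<open>w\<close> is reduced and \<open>l # w\<close> is not, the
        violation sits at the front: \<open>w\<close> starts with the inverse of \<open>l\<close>.
        The two letters cancel in the group, and by bijectivity of the generators also in the
        action.\<close>
      then obtain w' where w': "w = (\<not> fst l, snd l) # w'"
        using w(1) l by (cases w) (auto simp: reduced_words_def prod_eq_iff)
      then have red: "w' \<in> reduced_words S"
        using w(1) by (cases w') (auto simp: reduced_words_def)
      have c: "word_value G w' \<in> carrier G"
        using red S by (intro word_value_closed) (auto simp: reduced_words_def)
      have "letter_value G l \<otimes> g = word_value G w'"
        using c l S by (auto simp: w(2)[symmetric] w' letter_value_def simp flip: m_assoc)
      then have "\<rho> (letter_value G l \<otimes> g) = word_act w'" using \<rho>_word[OF red] by simp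
      also have "\<dots> = act l \<circ> word_act w"
        using cancel[OF l, of "\<not> fst l"] by (simp add: w' word_act_simps flip: comp_assoc)
      finally show ?thesis using \<rho>_word[OF w(1)] w(2) by simp
    qed
  qed
  show ?thesis
  proof
    have "[] \<in> reduced_words S" by (simp add: reduced_words_def)
    from \<rho>_word[OF this] show one: "\<rho> \<one> = id" by (simp add: word_act_simps)
    show "\<rho> s = f s" if "s \<in> S" for s
      using \<rho>_letter[of "(True, s)" \<one>] that S one by (auto simp: letter_value_def act_def)
    show "\<rho> (g \<otimes> h) = \<rho> g \<circ> \<rho> h" if g: "g \<in> carrier G" and h: "h \<in> carrier G" for g h
      using basis g
    proof (induction g rule: free_basis_induct)
      case one
      then show ?case using h \<open>\<rho> \<one> = id\<close> by simp
    next
      case (letter s x)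
      have s: "s \<in> carrier G" using letter(1) S by blast
      have "\<rho> (s \<otimes> x) = act (True, s) \<circ> \<rho> x"
        using \<rho>_letter[of "(True, s)" x] letter(1,2) by (simp add: letter_value_def)
      moreover have "\<rho> (s \<otimes> (x \<otimes> h)) = act (True, s) \<circ> \<rho> (x \<otimes> h)"
        using \<rho>_letter[of "(True, s)" "x \<otimes> h"] letter(1,2) h by (simp add: letter_value_def)
      ultimately show ?case using letter(2,3) s h by (simp add: m_assoc comp_assoc)
    next
      case (inv_letter s x)
      have s: "s \<in> carrier G" using inv_letter(1) S by blast
      have "\<rho> (inv s \<otimes> x) = act (False, s) \<circ> \<rho> x"
        using \<rho>_letter[of "(False, s)" x] inv_letter(1,2) by (simp add: letter_value_def)
      moreover have "\<rho> (inv s \<otimes> (x \<otimes> h)) = act (False, s) \<circ> \<rho> (x \<otimes> h)"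
        using \<rho>_letter[of "(False, s)" "x \<otimes> h"] inv_letter(1,2) h by (simp add: letter_value_def)
      ultimately show ?case using inv_letter(2,3) s h by (simp add: m_assoc comp_assoc)
    qed
  qed
qed

section \<open>Finite connected parts of the Cayley graph\<close>

text \<open>\<open>W\<close> is connected as a set of vertices of the Cayley graph, phrased as an induction principle.\<close>

definition cayley_connected :: "'a set \<Rightarrow> 'a set \<Rightarrow> bool"
  where "cayley_connected S W \<longleftrightarrow> W \<subseteq> carrier G \<and> \<one> \<in> W \<and>
           (\<forall>P. P \<one> \<longrightarrow> (\<forall>s\<in>S. \<forall>x\<in>W. s \<otimes> x \<in> W \<longrightarrow> (P x \<longleftrightarrow> P (s \<otimes> x))) \<longrightarrow> (\<forall>x\<in>W. P x))"

text \<open>The hypothesis is an equivalence because a path inside \<open>W\<close> may traverse an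
  edge in either direction.\<close>

lemma cayley_connectedD:
  assumes "cayley_connected S W" "P \<one>"
    and "\<And>s x. s \<in> S \<Longrightarrow> x \<in> W \<Longrightarrow> s \<otimes> x \<in> W \<Longrightarrow> P x \<longleftrightarrow> P (s \<otimes> x)"
    and "x \<in> W"
  shows "P x"
proof -
  have "P \<one> \<longrightarrow> (\<forall>s\<in>S. \<forall>x\<in>W. s \<otimes> x \<in> W \<longrightarrow> (P x \<longleftrightarrow> P (s \<otimes> x))) \<longrightarrow> (\<forall>x\<in>W. P x)"
    using assms(1) unfolding cayley_connected_def by (elim conjE) (drule spec[of _ P])
  then show ?thesis using assms(2-4) by simp
qed

lemma cayley_connected_one: "cayley_connected S {\<one>}"
  by (simp add: cayley_connected_def)

lemma cayley_connected_Un: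
  assumes "cayley_connected S V" "cayley_connected S W"
  shows "cayley_connected S (V \<union> W)"
  unfolding cayley_connected_def
proof (intro conjI allI impI)
  show "V \<union> W \<subseteq> carrier G" "\<one> \<in> V \<union> W" using assms by (auto simp: cayley_connected_def)
  fix P assume P: "P \<one>" "\<forall>s\<in>S. \<forall>x\<in>V \<union> W. s \<otimes> x \<in> V \<union> W \<longrightarrow> (P x \<longleftrightarrow> P (s \<otimes> x))"
  have "P x" if "x \<in> V" for x
    by (rule cayley_connectedD[OF assms(1), of P]) (use P that in auto)
  moreover have "P x" if "x \<in> W" for x
    by (rule cayley_connectedD[OF assms(2), of P]) (use P that in auto)
  ultimately show "\<forall>x\<in>V \<union> W. P x" by blast
qed

lemma cayley_connected_insert:
  assumes W: "cayley_connected S W" and x: "x \<in> W" and y: "y \<in> carrier G" and s: "s \<in> S"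
    and "y = s \<otimes> x \<or> x = s \<otimes> y"
  shows "cayley_connected S (insert y W)"
  unfolding cayley_connected_def
proof (intro conjI allI impI)
  show "insert y W \<subseteq> carrier G" "\<one> \<in> insert y W" using assms by (auto simp: cayley_connected_def)
  fix P assume P: "P \<one>"
    "\<forall>s\<in>S. \<forall>x\<in>insert y W. s \<otimes> x \<in> insert y W \<longrightarrow> (P x \<longleftrightarrow> P (s \<otimes> x))"
  have "P z" if "z \<in> W" for z
    by (rule cayley_connectedD[OF W, of P]) (use P that in auto)
  moreover have "P y \<longleftrightarrow> P x" using assms(5)
  proof
    assume "y = s \<otimes> x" then show ?thesis using P(2) s x by simp
  next
    assume "x = s \<otimes> y"
    then show ?thesis using P(2)[rule_format, OF s, of y] x by simp
  qed
  ultimately show "\<forall>x\<in>insert y W. P x" using x by blast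
qed

text \<open>The suffixes of a word for \<open>g\<close> form a path from \<open>\<one>\<close> to
  \<open>g\<close>. Finitely many such paths can be united, as they share the vertex
  \<open>\<one>\<close>.\<close>

lemma finite_cayley_connected:
  assumes basis: "free_basis G S" and "finite A" "A \<subseteq> carrier G"
  obtains W where "finite W" "A \<subseteq> W" "cayley_connected S W"
proof -
  have S: "S \<subseteq> carrier G" using basis by (simp add: free_basis_def)
  have single: "\<exists>W. finite W \<and> g \<in> W \<and> cayley_connected S W" if "g \<in> carrier G" for g
    using basis that
  proof (induction g rule: free_basis_induct)
    case one
    show ?case using cayley_connected_one by blast
  next
    case (letter s x)
    then obtain W where W: "finite W" "x \<in> W" "cayley_connected S W" by blast
    then have "cayley_connected S (insert (s \<otimes> x) W)"
      using letter S by (intro cayley_connected_insert[OF W(3,2)]) auto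
    then show ?case using W by blast
  next
    case (inv_letter s x)
    then obtain W where W: "finite W" "x \<in> W" "cayley_connected S W" by blast
    have "x = s \<otimes> (inv s \<otimes> x)" using inv_letter S by (auto simp flip: m_assoc)
    then have "cayley_connected S (insert (inv s \<otimes> x) W)"
      using inv_letter S by (intro cayley_connected_insert[OF W(3,2)]) auto
    then show ?case using W by blast
  qed
  have "\<exists>W. finite W \<and> A \<subseteq> W \<and> cayley_connected S W"
    using assms(2,3)
  proof (induction A)
    case empty
    show ?case using cayley_connected_one by blast
  next
    case (insert a A)
    then obtain V W where "finite V" "a \<in> V" "cayley_connected S V"
      "finite W" "A \<subseteq> W" "cayley_connected S W"
      using single[of a] by blast
    then show ?case using cayley_connected_Un by (intro exI[of _ "V \<union> W"]) auto
  qed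
  then show ?thesis using that by blast
qed

text \<open>With \<open>s\<close> as the only generator every element would be a power of
  \<open>s\<close>, and powers of one element commute.\<close>

lemma free_basis_two_generators:
  assumes basis: "free_basis G S" and nc: "\<not> comm_group G" and s: "s \<in> S"
  obtains t where "t \<in> S" "t \<noteq> s"
proof -
  have S: "S \<subseteq> carrier G" using basis by (simp add: free_basis_def)
  have "\<exists>t\<in>S. t \<noteq> s"
  proof (rule ccontr)
    assume "\<not> (\<exists>t\<in>S. t \<noteq> s)"
    then have S': "t = s" if "t \<in> S" for t using that by blast
    have sc: "s \<in> carrier G" using s S by blast
    have powers: "\<exists>k::int. g = s [^] k" if "g \<in> carrier G" for g
      using basis that
    proof (induction g rule: free_basis_induct)
      case one
      show ?case by (metis int_pow_0)
    next
      case (letter u x)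
      then obtain k :: int where "x = s [^] k" by blast
      then have "u \<otimes> x = s [^] (1 + k)"
        using S'[OF letter(1)] sc by (simp add: int_pow_mult)
      then show ?case by blast
    next
      case (inv_letter u x)
      then obtain k :: int where "x = s [^] k" by blast
      moreover have "s [^] (- 1 + k) = inv s \<otimes> s [^] k"
        unfolding int_pow_mult[OF sc] using int_pow_neg[OF sc, of 1] sc by simp
      ultimately have "inv u \<otimes> x = s [^] (- 1 + k)"
        using S'[OF inv_letter(1)] by simp
      then show ?case by blast
    qed
    have "comm_group G"
    proof (rule group_comm_groupI)
      fix x y assume "x \<in> carrier G" "y \<in> carrier G"
      then obtain j k :: int where "x = s [^] j" "y = s [^] k" using powers by metis
      then show "x \<otimes> y = y \<otimes> x" using sc by (simp add: add.commute flip: int_pow_mult)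
    qed
    then show False using nc by simp
  qed
  then show ?thesis using that by blast
qed

lemma free_basis_nonempty:
  assumes "free_basis G S" and "\<not> comm_group G"
  shows "S \<noteq> {}"
proof
  assume "S = {}"
  have "g = \<one>" if "g \<in> carrier G" for g
    using assms(1) that \<open>S = {}\<close> by (induction g rule: free_basis_induct) auto
  then have "comm_group G" by (intro group_comm_groupI) auto
  then show False using assms(2) by simp
qed

end

section \<open>Left-preorders as sign maps\<close>

text \<open>The points are added in increasing order. To the right of the previous maximum the map
  is replaced by an affine ray whose slope hits the new value; positivity of the slope preserves
  monotonicity and surjectivity.\<close>

lemma extend_strict_mono_real:
  fixes D :: "real set"
  assumes "finite D" "strict_mono_on D h"
  obtains f :: "real \<Rightarrow> real" where "strict_mono f" "surj f" "\<And>x. x \<in> D \<Longrightarrow> f x = h x"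
proof -
  have "\<exists>f :: real \<Rightarrow> real. strict_mono f \<and> surj f \<and> (\<forall>x\<in>D. f x = h x)"
    using assms
  proof (induction D rule: finite_linorder_max_induct)
    case empty
    show ?case by (intro exI[of _ id]) (auto simp: strict_mono_def)
  next
    case (insert b A)
    then obtain f where f: "strict_mono f" "surj f" "\<forall>x\<in>A. f x = h x"
      by (auto simp: strict_mono_on_def)
    show ?case
    proof (cases "A = {}")
      case True
      then show ?thesis by (intro exI[of _ "\<lambda>x. x + (h b - b)"])
          (auto simp: strict_mono_def surj_def intro: exI[of _ "_ - (h b - b)"])
    next
      case False
      define a where "a = Max A"
      have a: "a \<in> A" "\<And>x. x \<in> A \<Longrightarrow> x \<le> a" using insert(1) False by (auto simp: a_def)
      have ab: "a < b" using insert(2) a by blast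
      have hab: "f a < h b" using f(3) a insert ab by (auto simp: strict_mono_on_def)
      define m where "m = (h b - f a) / (b - a)"
      have m: "m > 0" using ab hab by (simp add: m_def)
      define g where "g x = (if x \<le> a then f x else f a + m * (x - a))" for x
      have "strict_mono g"
      proof (rule strict_monoI)
        fix x y :: real assume "x < y"
        moreover have "f x \<le> f a" if "x \<le> a"
          using that f(1) by (simp add: strict_mono_less_eq)
        ultimately show "g x < g y"
          using f(1) m by (auto simp: g_def strict_mono_less intro: add_strict_increasing2)
            (smt (verit) mult_pos_pos)
      qed
      moreover have "surj g"
        unfolding surj_def
      proof
        fix y
        obtain x where x: "y = f x" using f(2) by blast
        show "\<exists>x. y = g x"
        proof (cases "x \<le> a")
          case True
          then show ?thesis using x by (auto simp: g_def)
        next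
          case False
          then have "y > f a" using x f(1) by (simp add: strict_mono_less)
          then have "y = g (a + (y - f a) / m)" using m by (auto simp: g_def field_simps)
          then show ?thesis by blast
        qed
      qed
      moreover have "\<forall>x\<in>insert b A. g x = h x"
        using a ab f(3) by (auto simp: g_def m_def)
      ultimately show ?thesis by blast
    qed
  qed
  then show ?thesis using that by blast
qed

text \<open>The families need not be injective, since equivalent group elements will occupy the same
  point. The order hypothesis turns ties in \<open>p\<close> into ties in \<open>q\<close>, so
  sending \<open>p i\<close> to \<open>q i\<close> is well defined.\<close>

lemma extend_order_embedding_real:
  fixes p q :: "'i \<Rightarrow> real"
  assumes I: "finite I" and pq: "\<And>i j. i \<in> I \<Longrightarrow> j \<in> I \<Longrightarrow> p i \<le> p j \<longleftrightarrow> q i \<le> q j"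
  obtains f :: "real \<Rightarrow> real" where "strict_mono f" "surj f" "\<And>i. i \<in> I \<Longrightarrow> f (p i) = q i"
proof -
  define h where "h x = q (SOME i. i \<in> I \<and> p i = x)" for x
  have h: "h (p i) = q i" if "i \<in> I" for i
  proof -
    define j where "j = (SOME j. j \<in> I \<and> p j = p i)"
    have j: "j \<in> I \<and> p j = p i"
      unfolding j_def by (rule someI[of _ i]) (use that in simp)
    then have "q j = q i" using pq[of i j] pq[of j i] that by simp
    then show ?thesis by (simp add: h_def j_def)
  qed
  have "strict_mono_on (p ` I) h"
    by (rule strict_mono_onI) (auto simp: h pq simp flip: not_le)
  then obtain f where "strict_mono f" "surj f" "\<And>x. x \<in> p ` I \<Longrightarrow> f x = h x"
    using extend_strict_mono_real[of "p ` I" h] I by blast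
  then show ?thesis using that h by auto
qed

context group
begin

section \<open>Algebra of sign maps\<close>

lemma inv_cancel:
  assumes "x \<in> carrier G" "y \<in> carrier G"
  shows "x \<otimes> (inv x \<otimes> y) = y" "inv x \<otimes> (x \<otimes> y) = y"
  using assms by (simp_all flip: m_assoc)

text \<open>The sign maps are, up to restriction to the carrier, the maps \<open>\<phi>\<^sub>\<preceq>\<close> of left-preorders together
  with the zero map, where \<open>\<phi> (inv x \<otimes> y) \<ge> 0\<close> stands for \<open>x \<preceq> y\<close>.\<close>

definition sign_map :: "('a \<Rightarrow> int) \<Rightarrow> bool"
  where "sign_map \<phi> \<longleftrightarrow> (\<forall>g\<in>carrier G. \<phi> g \<in> {1, - 1, 0} \<and> \<phi> (inv g) = - \<phi> g) \<and>
           (\<forall>g\<in>carrier G. \<forall>h\<in>carrier G. \<phi> g \<ge> 0 \<longrightarrow> \<phi> h \<ge> 0 \<longrightarrow> \<phi> (g \<otimes> h) \<ge> 0)"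

lemma sign_map_values: "sign_map \<phi> \<Longrightarrow> g \<in> carrier G \<Longrightarrow> \<phi> g = 1 \<or> \<phi> g = - 1 \<or> \<phi> g = 0"
  by (auto simp: sign_map_def)

lemma sign_map_inv: "sign_map \<phi> \<Longrightarrow> g \<in> carrier G \<Longrightarrow> \<phi> (inv g) = - \<phi> g"
  by (simp add: sign_map_def)

lemma sign_map_mult_nonneg:
  "sign_map \<phi> \<Longrightarrow> g \<in> carrier G \<Longrightarrow> h \<in> carrier G \<Longrightarrow> \<phi> g \<ge> 0 \<Longrightarrow> \<phi> h \<ge> 0 \<Longrightarrow> \<phi> (g \<otimes> h) \<ge> 0"
  by (simp add: sign_map_def)

lemma sign_map_mult_nonpos:
  assumes "sign_map \<phi>" "g \<in> carrier G" "h \<in> carrier G" "\<phi> g \<le> 0" "\<phi> h \<le> 0"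
  shows "\<phi> (g \<otimes> h) \<le> 0"
  using sign_map_mult_nonneg[of \<phi> "inv h" "inv g"] sign_map_inv[of \<phi>] assms
  by (auto simp flip: inv_mult_group)

lemma sign_map_one: "sign_map \<phi> \<Longrightarrow> \<phi> \<one> = 0"
  using sign_map_inv[of \<phi> \<one>] by simp

lemma sign_map_trans:
  assumes \<phi>: "sign_map \<phi>" and c: "x \<in> carrier G" "y \<in> carrier G" "z \<in> carrier G"
    and "\<phi> (inv x \<otimes> y) \<ge> 0" "\<phi> (inv y \<otimes> z) \<ge> 0"
  shows "\<phi> (inv x \<otimes> z) \<ge> 0"
proof -
  have "(inv x \<otimes> y) \<otimes> (inv y \<otimes> z) = inv x \<otimes> z" using c by (simp add: m_assoc inv_cancel)
  then show ?thesis
    using sign_map_mult_nonneg[OF \<phi>, of "inv x \<otimes> y" "inv y \<otimes> z"] assms by simp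
qed

lemma sign_map_swap:
  assumes "sign_map \<phi>" "x \<in> carrier G" "y \<in> carrier G"
  shows "\<phi> (inv y \<otimes> x) = - \<phi> (inv x \<otimes> y)"
  using sign_map_inv[of \<phi> "inv x \<otimes> y"] assms by (simp add: inv_mult_group)

lemma sign_map_mult_zero:
  assumes "sign_map \<phi>" "g \<in> carrier G" "h \<in> carrier G" "\<phi> g = 0" "\<phi> h = 0"
  shows "\<phi> (g \<otimes> h) = 0"
  using sign_map_mult_nonneg[of \<phi> g h] sign_map_mult_nonpos[of \<phi> g h] assms by simp

text \<open>If \<open>g \<otimes> h\<close> has sign 0, then \<open>inv g\<close> is
  \<open>h\<close> times its inverse, a product of elements of nonnegative sign; the same works for
  \<open>inv h\<close>. This convexity of the kernel is what the lexicographic refinement relies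
  on.\<close>

lemma sign_map_mult_eq_zeroD:
  assumes \<phi>: "sign_map \<phi>" and g: "g \<in> carrier G" and h: "h \<in> carrier G"
    and "\<phi> g \<ge> 0" "\<phi> h \<ge> 0" "\<phi> (g \<otimes> h) = 0"
  shows "\<phi> g = 0 \<and> \<phi> h = 0"
proof -
  have "\<phi> (h \<otimes> inv (g \<otimes> h)) \<ge> 0" "\<phi> (inv (g \<otimes> h) \<otimes> g) \<ge> 0"
    using g h assms(4-6) sign_map_inv[OF \<phi>, of "g \<otimes> h"]
    by (simp_all add: sign_map_mult_nonneg[OF \<phi>])
  moreover have "h \<otimes> inv (g \<otimes> h) = inv g" "inv (g \<otimes> h) \<otimes> g = inv h"
    using g h by (simp_all add: inv_mult_group inv_cancel m_assoc)
  ultimately have "- \<phi> g \<ge> 0" "- \<phi> h \<ge> 0"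
    using sign_map_inv[OF \<phi> g] sign_map_inv[OF \<phi> h] by simp_all
  then show ?thesis using assms(4,5) by linarith
qed

text \<open>It lets agreement on a finite generating set control the sign on a whole finitely
  generated subgroup.\<close>

lemma sign_map_kernel_generate:
  assumes \<phi>: "sign_map \<phi>" and S: "S \<subseteq> carrier G" "\<And>s. s \<in> S \<Longrightarrow> \<phi> s = 0"
    and g: "g \<in> generate G S"
  shows "\<phi> g = 0"
  using g
proof (induction g)
  case (eng x y)
  then show ?case
    using sign_map_mult_zero[OF \<phi>] generate_in_carrier[OF S(1)] by blast
qed (use S sign_map_one[OF \<phi>] sign_map_inv[OF \<phi>] in auto)

text \<open>A perturbation \<open>\<psi>\<close> of \<open>\<phi>\<close> may have a larger kernel; refining it by \<open>\<phi>\<close> restores the old one.\<close>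

lemma sign_map_lex:
  assumes \<psi>: "sign_map \<psi>" and \<phi>: "sign_map \<phi>"
  shows "sign_map (\<lambda>g. if \<psi> g = 0 then \<phi> g else \<psi> g)"
  unfolding sign_map_def
proof (intro conjI ballI impI)
  fix g h assume g: "g \<in> carrier G" and h: "h \<in> carrier G"
  show "(if \<psi> g = 0 then \<phi> g else \<psi> g) \<in> {1, - 1, 0}"
    using sign_map_values[OF \<psi> g] sign_map_values[OF \<phi> g] by auto
  show "(if \<psi> (inv g) = 0 then \<phi> (inv g) else \<psi> (inv g)) = - (if \<psi> g = 0 then \<phi> g else \<psi> g)"
    using sign_map_inv[OF \<psi> g] sign_map_inv[OF \<phi> g] by auto
  assume "(if \<psi> g = 0 then \<phi> g else \<psi> g) \<ge> 0" "(if \<psi> h = 0 then \<phi> h else \<psi> h) \<ge> 0"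
  moreover from this have "\<psi> g \<ge> 0" "\<psi> h \<ge> 0" by (auto split: if_splits)
  \<comment> \<open>If \<open>\<psi>\<close> vanishes on the product, convexity makes it vanish on
    both factors, so all three signs are decided by \<open>\<phi>\<close>.\<close>
  ultimately show "(if \<psi> (g \<otimes> h) = 0 then \<phi> (g \<otimes> h) else \<psi> (g \<otimes> h)) \<ge> 0"
    using sign_map_mult_nonneg[OF \<psi> g h] sign_map_mult_nonneg[OF \<phi> g h]
      sign_map_mult_eq_zeroD[OF \<psi> g h] by auto
qed

section \<open>Passage between sign maps and orbits on the line\<close>

text \<open>The underlying preorder compares \<open>g\<close> and \<open>h\<close> by the positions
  of \<open>\<rho> g x\<close> and \<open>\<rho> h x\<close>; its kernel is the stabiliser of
  \<open>x\<close>.\<close>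

lemma sign_map_orbit:
  fixes \<rho> :: "'a \<Rightarrow> real \<Rightarrow> real"
  assumes one: "\<rho> \<one> = id"
    and mult: "\<And>g h. g \<in> carrier G \<Longrightarrow> h \<in> carrier G \<Longrightarrow> \<rho> (g \<otimes> h) = \<rho> g \<circ> \<rho> h"
    and mono: "\<And>g. g \<in> carrier G \<Longrightarrow> strict_mono (\<rho> g)"
  shows "sign_map (\<lambda>g. if \<rho> g x > x then 1 else if \<rho> g x < x then - 1 else 0)"
proof -
  have inv: "\<rho> (inv g) x > x \<longleftrightarrow> \<rho> g x < x" "\<rho> (inv g) x < x \<longleftrightarrow> \<rho> g x > x"
    if g: "g \<in> carrier G" for g
  proof -
    have "\<rho> g (\<rho> (inv g) x) = x"
      using mult[OF g inv_closed[OF g]] one g by (simp add: fun_eq_iff)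
    then show "\<rho> (inv g) x > x \<longleftrightarrow> \<rho> g x < x" "\<rho> (inv g) x < x \<longleftrightarrow> \<rho> g x > x"
      using strict_mono_less[OF mono[OF g]] by metis+
  qed
  have "\<rho> (g \<otimes> h) x \<ge> x" if g: "g \<in> carrier G" and h: "h \<in> carrier G"
    and "\<rho> g x \<ge> x" "\<rho> h x \<ge> x" for g h
  proof -
    have "\<rho> g x \<le> \<rho> g (\<rho> h x)" using mono[OF g] that by (simp add: strict_mono_less_eq)
    then show ?thesis using mult[OF g h] that by simp
  qed
  then have "\<not> \<rho> (g \<otimes> h) x < x"
    if "g \<in> carrier G" "h \<in> carrier G" "\<not> \<rho> g x < x" "\<not> \<rho> h x < x" for g h
    using that by (simp add: not_less)
  then show ?thesis
    by (auto simp: sign_map_def inv split: if_splits)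
qed

text \<open>The position of \<open>x\<close> is its rank, the number of elements of \<open>W\<close>
  that precede it. Integer positions matter later: inequivalent elements are at distance at least
  1.\<close>

lemma finite_preorder_embedding:
  assumes \<phi>: "sign_map \<phi>" and W: "finite W" "W \<subseteq> carrier G"
  obtains \<pi> :: "'a \<Rightarrow> real"
  where "\<And>x y. x \<in> W \<Longrightarrow> y \<in> W \<Longrightarrow> \<pi> x \<le> \<pi> y \<longleftrightarrow> \<phi> (inv x \<otimes> y) \<ge> 0"
    and "\<And>x. \<exists>n::nat. \<pi> x = real n"
proof -
  define D where "D x = {z \<in> W. \<phi> (inv z \<otimes> x) \<ge> 0}" for x
  have trans: "\<phi> (inv x \<otimes> z) \<ge> 0"
    if "x \<in> W" "y \<in> W" "z \<in> W" "\<phi> (inv x \<otimes> y) \<ge> 0" "\<phi> (inv y \<otimes> z) \<ge> 0" for x y z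
    using sign_map_trans[OF \<phi>, of x y z] that subsetD[OF W(2)] by simp
  have swap: "\<phi> (inv y \<otimes> x) = - \<phi> (inv x \<otimes> y)" if "x \<in> W" "y \<in> W" for x y
    using sign_map_swap[OF \<phi>] that W by blast
  have fin: "finite (D x)" for x using W by (simp add: D_def)
  have refl: "x \<in> D x" if "x \<in> W" for x
    using that W sign_map_one[OF \<phi>] by (auto simp: D_def subset_iff)
  have iff: "card (D x) \<le> card (D y) \<longleftrightarrow> \<phi> (inv x \<otimes> y) \<ge> 0" if x: "x \<in> W" and y: "y \<in> W" for x y
  proof
    assume le: "\<phi> (inv x \<otimes> y) \<ge> 0"
    have "D x \<subseteq> D y"
    proof
      fix z assume "z \<in> D x"
      then show "z \<in> D y" using trans[of z x y] x y le by (simp add: D_def)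
    qed
    then show "card (D x) \<le> card (D y)" using fin by (simp add: card_mono)
  next
    assume le: "card (D x) \<le> card (D y)"
    show "\<phi> (inv x \<otimes> y) \<ge> 0"
    proof (rule ccontr)
      assume less: "\<not> \<phi> (inv x \<otimes> y) \<ge> 0"
      then have "\<phi> (inv y \<otimes> x) \<ge> 0" using swap[OF x y] by simp
      then have "z \<in> D x" if "z \<in> D y" for z
        using trans[of z y x] that x y by (simp add: D_def)
      moreover have "x \<notin> D y" using less by (simp add: D_def)
      ultimately have "D y \<subseteq> D x" "x \<notin> D y" by blast+
      then have "D y \<subset> D x" using refl x by blast
      then show False using le fin psubset_card_mono by (metis not_le)
    qed
  qed
  show ?thesis
    by (rule that[of "\<lambda>x. real (card (D x))"]) (use iff in auto)
qed

text \<open>Any choice of increasing bijections for the generators yields an action by increasing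
  maps: inverses of the generators are increasing because strictly increasing maps also reflect the
  order.\<close>

lemma free_basis_sign_map_orbit:
  assumes basis: "free_basis G S"
    and f: "\<And>s. s \<in> S \<Longrightarrow> strict_mono (f s)" "\<And>s. s \<in> S \<Longrightarrow> surj (f s)"
  obtains \<rho> :: "'a \<Rightarrow> real \<Rightarrow> real" where "\<rho> \<one> = id"
    and "\<And>g h. g \<in> carrier G \<Longrightarrow> h \<in> carrier G \<Longrightarrow> \<rho> (g \<otimes> h) = \<rho> g \<circ> \<rho> h"
    and "\<And>s. s \<in> S \<Longrightarrow> \<rho> s = f s"
    and "\<And>g. g \<in> carrier G \<Longrightarrow> strict_mono (\<rho> g)"
    and "\<And>x. sign_map (\<lambda>g. if \<rho> g x > x then 1 else if \<rho> g x < x then - 1 else 0)"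
proof -
  have S: "S \<subseteq> carrier G" using basis by (simp add: free_basis_def)
  have "bij (f s)" if "s \<in> S" for s
    using f[OF that] strict_mono_imp_inj_on by (simp add: bij_def)
  then obtain \<rho> where \<rho>: "\<rho> \<one> = id"
    "\<And>g h. g \<in> carrier G \<Longrightarrow> h \<in> carrier G \<Longrightarrow> \<rho> (g \<otimes> h) = \<rho> g \<circ> \<rho> h"
    "\<And>s. s \<in> S \<Longrightarrow> \<rho> s = f s"
    using free_basis_action[OF basis, of f] by metis
  have "strict_mono (\<rho> g)" if "g \<in> carrier G" for g
    using basis that
  proof (induction g rule: free_basis_induct)
    case one
    show ?case by (simp add: \<rho>(1) strict_mono_def)
  next
    case (letter s x)
    then have "\<rho> (s \<otimes> x) = f s \<circ> \<rho> x" using \<rho> S by auto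
    then show ?case using letter f(1)[OF letter(1)] by (simp add: strict_mono_def)
  next
    case (inv_letter s x)
    have s: "s \<in> carrier G" using inv_letter S by blast
    have "\<rho> s \<circ> \<rho> (inv s \<otimes> x) = \<rho> x"
      using \<rho>(2)[of s "inv s \<otimes> x"] inv_letter s by (simp add: inv_cancel)
    then have "f s (\<rho> (inv s \<otimes> x) y) = \<rho> x y" for y
      using \<rho>(3)[OF inv_letter(1)] by (metis comp_apply)
    then show ?case
      using inv_letter(3) strict_mono_less[OF f(1)[OF inv_letter(1)]] by (metis strict_mono_def)
  qed
  then show ?thesis using that \<rho> sign_map_orbit[of \<rho>] by blast
qed

section \<open>Perturbation away from a finite set\<close>

text \<open>Suppose no letter moves \<open>u\<close> up. Applying this to \<open>s\<close> and to
  \<open>inv s\<close>, left-invariance makes \<open>s \<otimes> u\<close> equivalent to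
  \<open>u\<close> for every generator. Then all of the group fixes the class of \<open>u\<close>,
  so every conjugate by \<open>u\<close>, hence every element, has sign 0.\<close>

lemma sign_map_increasing_letter:
  assumes basis: "free_basis G S" and \<phi>: "sign_map \<phi>"
    and nz: "g \<in> carrier G" "\<phi> g \<noteq> 0" and u: "u \<in> carrier G"
  shows "\<exists>s\<in>S. \<exists>v\<in>carrier G. (v = s \<otimes> u \<or> u = s \<otimes> v) \<and> \<phi> (inv v \<otimes> u) < 0"
proof (rule ccontr)
  have S: "S \<subseteq> carrier G" using basis by (simp add: free_basis_def)
  assume "\<not> ?thesis"
  then have *: "\<phi> (inv v \<otimes> u) \<ge> 0"
    if "s \<in> S" "v \<in> carrier G" "v = s \<otimes> u \<or> u = s \<otimes> v" for s v
    using that unfolding not_less[symmetric] by blast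
  have fix_s: "\<phi> (inv u \<otimes> (s \<otimes> u)) = 0" if s: "s \<in> S" for s
  proof -
    have sc: "s \<in> carrier G" using s S by blast
    have "\<phi> (inv (s \<otimes> u) \<otimes> u) \<ge> 0" using *[OF s, of "s \<otimes> u"] sc u by simp
    moreover have "\<phi> (inv (inv s \<otimes> u) \<otimes> u) \<ge> 0"
      using *[OF s, of "inv s \<otimes> u"] sc u by (simp add: inv_cancel)
    moreover have "inv (inv s \<otimes> u) \<otimes> u = inv u \<otimes> (s \<otimes> u)"
      using sc u by (simp add: inv_mult_group m_assoc)
    ultimately show ?thesis using sign_map_swap[OF \<phi>, of u "s \<otimes> u"] sc u by simp
  qed
  have "\<phi> (inv u \<otimes> (x \<otimes> u)) = 0" if "x \<in> carrier G" for x
    using basis that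
  proof (induction x rule: free_basis_induct)
    case one
    then show ?case using u sign_map_one[OF \<phi>] by simp
  next
    case (letter s x)
    then have "s \<in> carrier G" using S by blast
    then have "inv u \<otimes> (s \<otimes> x \<otimes> u) = (inv u \<otimes> (s \<otimes> u)) \<otimes> (inv u \<otimes> (x \<otimes> u))"
      using letter u by (simp add: m_assoc inv_cancel)
    then show ?case
      using sign_map_mult_zero[OF \<phi>, of "inv u \<otimes> (s \<otimes> u)" "inv u \<otimes> (x \<otimes> u)"] letter u
        \<open>s \<in> carrier G\<close> fix_s by simp
  next
    case (inv_letter s x)
    then have s: "s \<in> carrier G" using S by blast
    then have "inv u \<otimes> (inv s \<otimes> x \<otimes> u) = inv (inv u \<otimes> (s \<otimes> u)) \<otimes> (inv u \<otimes> (x \<otimes> u))"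
      using inv_letter u by (simp add: m_assoc inv_cancel inv_mult_group)
    then show ?case
      using sign_map_mult_zero[OF \<phi>, of "inv (inv u \<otimes> (s \<otimes> u))" "inv u \<otimes> (x \<otimes> u)"] inv_letter u
        s fix_s sign_map_inv[OF \<phi>, of "inv u \<otimes> (s \<otimes> u)"] by simp
  qed
  from this[of "u \<otimes> g \<otimes> inv u"] show False
    using nz u by (simp add: m_assoc inv_cancel)
qed

text \<open>Two maps with opposite signs at \<open>h\<close> are produced because the sign of
  \<open>\<phi>\<close> at \<open>h\<close> is not known: whatever it is, one of the two differs
  from \<open>\<phi>\<close> there.\<close>

lemma sign_map_perturbation:
  assumes basis: "free_basis G S" and nc: "\<not> comm_group G"
    and \<phi>: "sign_map \<phi>" and nz: "g \<in> carrier G" "\<phi> g \<noteq> 0"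
    and A: "finite A" "A \<subseteq> carrier G"
  obtains h \<phi>\<^sub>1 \<phi>\<^sub>2 where "h \<in> carrier G" "sign_map \<phi>\<^sub>1" "sign_map \<phi>\<^sub>2"
    "\<And>a. a \<in> A \<Longrightarrow> \<phi>\<^sub>1 a = \<phi> a" "\<And>a. a \<in> A \<Longrightarrow> \<phi>\<^sub>2 a = \<phi> a" "\<phi>\<^sub>1 h = 1" "\<phi>\<^sub>2 h = - 1"
proof -
  have S: "S \<subseteq> carrier G" using basis by (simp add: free_basis_def)
  obtain W where W: "finite W" "A \<subseteq> W" "cayley_connected S W"
    using finite_cayley_connected[OF basis A] .
  have Wc: "W \<subseteq> carrier G" "\<one> \<in> W" using W(3) by (auto simp: cayley_connected_def)
  obtain u where u: "u \<in> W" "\<And>w. w \<in> W \<Longrightarrow> \<phi> (inv w \<otimes> u) \<ge> 0"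
  proof -
    obtain \<pi> :: "'a \<Rightarrow> real"
      where \<pi>: "\<And>x y. x \<in> W \<Longrightarrow> y \<in> W \<Longrightarrow> \<pi> x \<le> \<pi> y \<longleftrightarrow> \<phi> (inv x \<otimes> y) \<ge> 0"
      using finite_preorder_embedding[OF \<phi> W(1) Wc(1)] by metis
    have "Max (\<pi> ` W) \<in> \<pi> ` W" using W(1) Wc(2) by (intro Max_in) auto
    then obtain u where "u \<in> W" "\<pi> u = Max (\<pi> ` W)" by auto
    then show ?thesis using that[of u] \<pi> W(1) by (metis Max_ge finite_imageI imageI)
  qed
  have uc: "u \<in> carrier G" using u Wc by blast
  obtain s v where sv: "s \<in> S" "v \<in> carrier G" "v = s \<otimes> u \<or> u = s \<otimes> v" "\<phi> (inv v \<otimes> u) < 0"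
    using sign_map_increasing_letter[OF basis \<phi> nz uc] by blast
  obtain t where t: "t \<in> S" "t \<noteq> s" using free_basis_two_generators[OF basis nc sv(1)] .
  have tc: "t \<in> carrier G" using t S by blast
  txt \<open>Since \<open>v\<close> lies above \<open>W\<close> and is reached through the letter \<open>s\<close>, nothing constrains
    the image of \<open>v\<close> under \<open>t\<close>: it may be placed on either side of \<open>v\<close>.\<close>
  define V where "V = insert v W"
  have V: "cayley_connected S V"
    unfolding V_def by (rule cayley_connected_insert[OF W(3) u(1) sv(2,1,3)])
  have Vc: "V \<subseteq> carrier G" "finite V" using Wc sv W by (auto simp: V_def)
  obtain \<pi> :: "'a \<Rightarrow> real"
    where \<pi>: "\<And>x y. x \<in> V \<Longrightarrow> y \<in> V \<Longrightarrow> \<pi> x \<le> \<pi> y \<longleftrightarrow> \<phi> (inv x \<otimes> y) \<ge> 0"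
      and \<pi>_nat: "\<And>x. \<exists>n::nat. \<pi> x = real n"
    using finite_preorder_embedding[OF \<phi> Vc(2,1)] by metis
  have v_top: "\<pi> w \<le> \<pi> v - 1" if w: "w \<in> W" for w
  proof -
    have "\<not> \<phi> (inv v \<otimes> w) \<ge> 0"
      using sign_map_trans[OF \<phi>, of v w u] u(2)[OF w] sv uc w Wc by auto
    then have "\<pi> w < \<pi> v" using \<pi>[of v w] w by (auto simp: V_def)
    moreover obtain m n :: nat where "\<pi> w = real m" "\<pi> v = real n" using \<pi>_nat by metis
    ultimately show ?thesis by simp
  qed
  then have "v \<notin> W" by force
  have left_inv: "\<pi> (a \<otimes> x) \<le> \<pi> (a \<otimes> y) \<longleftrightarrow> \<pi> x \<le> \<pi> y"
    if "a \<in> S" "x \<in> V" "y \<in> V" "a \<otimes> x \<in> V" "a \<otimes> y \<in> V" for a x y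
  proof -
    have "a \<in> carrier G" "x \<in> carrier G" "y \<in> carrier G" using that S Vc by auto
    then have "inv (a \<otimes> x) \<otimes> (a \<otimes> y) = inv x \<otimes> y"
      by (simp add: inv_mult_group m_assoc inv_cancel)
    then show ?thesis using that \<pi> by simp
  qed
  \<comment> \<open>Translating by \<open>v\<close> turns the comparison of \<open>\<one>\<close>
    with \<open>h\<close> into that of \<open>v\<close> with \<open>t \<otimes> v\<close>, so the
    sign at \<open>h\<close> records where \<open>t\<close> sends \<open>v\<close>.\<close>
  define h where "h = inv v \<otimes> (t \<otimes> v)"
  have h: "h \<in> carrier G" "v \<otimes> h = t \<otimes> v" using sv tc by (auto simp: h_def inv_cancel)
  \<comment> \<open>As \<open>v\<close> clears \<open>W\<close> by at least 1, a shift by 1/2 either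
    way keeps the image of \<open>v\<close> above all prescribed images, which lie among the
    positions of \<open>W\<close>.\<close>
  have step: "\<exists>\<psi>. sign_map \<psi> \<and> (\<forall>a\<in>A. \<psi> a = \<phi> a) \<and> \<psi> h = (if e > 0 then 1 else - 1)"
    if e: "\<bar>e\<bar> = 1/2" for e :: real
  proof -
    \<comment> \<open>The generator \<open>t\<close> is prescribed only on edges inside
      \<open>W\<close> and at \<open>v\<close>. The other generators, \<open>s\<close> among them,
      must also respect edges that touch \<open>v\<close>; this attaches \<open>v\<close> to
      \<open>W\<close>.\<close>
    have "\<forall>a\<in>S. \<exists>f :: real \<Rightarrow> real. strict_mono f \<and> surj f \<and>
        (if a = t then f (\<pi> v) = \<pi> v + e \<and> (\<forall>x\<in>W. a \<otimes> x \<in> W \<longrightarrow> f (\<pi> x) = \<pi> (a \<otimes> x))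
         else \<forall>x\<in>V. a \<otimes> x \<in> V \<longrightarrow> f (\<pi> x) = \<pi> (a \<otimes> x))"
    proof
      fix a assume a: "a \<in> S"
      show "\<exists>f :: real \<Rightarrow> real. strict_mono f \<and> surj f \<and>
        (if a = t then f (\<pi> v) = \<pi> v + e \<and> (\<forall>x\<in>W. a \<otimes> x \<in> W \<longrightarrow> f (\<pi> x) = \<pi> (a \<otimes> x))
         else \<forall>x\<in>V. a \<otimes> x \<in> V \<longrightarrow> f (\<pi> x) = \<pi> (a \<otimes> x))"
      proof (cases "a = t")
        case True
        define q where "q x = (if x = v then \<pi> v + e else \<pi> (a \<otimes> x))" for x
        define I where "I = insert v {x \<in> W. a \<otimes> x \<in> W}"
        obtain f where f: "strict_mono f" "surj f" "\<And>i. i \<in> I \<Longrightarrow> f (\<pi> i) = q i"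
        proof (rule extend_order_embedding_real[of I \<pi> q])
          show "finite I" using W by (simp add: I_def)
          have small: "\<not> \<pi> v \<le> \<pi> x" "\<pi> x \<le> \<pi> v" "\<not> \<pi> v + e \<le> \<pi> (a \<otimes> x)" "\<pi> (a \<otimes> x) \<le> \<pi> v + e" if "x \<in> W" "a \<otimes> x \<in> W" for x
            using v_top[OF that(1)] v_top[OF that(2)] e by linarith+
          show "\<pi> i \<le> \<pi> j \<longleftrightarrow> q i \<le> q j" if "i \<in> I" "j \<in> I" for i j
            using that small left_inv[OF a, of i j] \<open>v \<notin> W\<close>
            by (auto simp: I_def q_def V_def)
        qed (rule that)
        have "f (\<pi> x) = \<pi> (a \<otimes> x)" if "x \<in> W" "a \<otimes> x \<in> W" for x
          using f(3)[of x] that \<open>v \<notin> W\<close> by (auto simp: I_def q_def)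
        moreover have "f (\<pi> v) = \<pi> v + e" using f(3)[of v] by (simp add: I_def q_def)
        ultimately show ?thesis using f(1,2) True by auto
      next
        case False
        obtain f where "strict_mono f" "surj f" "\<And>x. x \<in> {x \<in> V. a \<otimes> x \<in> V} \<Longrightarrow> f (\<pi> x) = \<pi> (a \<otimes> x)"
          by (rule extend_order_embedding_real[of "{x \<in> V. a \<otimes> x \<in> V}" \<pi> "\<lambda>x. \<pi> (a \<otimes> x)"])
            (use Vc left_inv[OF a] in auto)
        then show ?thesis using False by auto
      qed
    qed
    then obtain f :: "'a \<Rightarrow> real \<Rightarrow> real" where f: "\<And>a. a \<in> S \<Longrightarrow> strict_mono (f a)" "\<And>a. a \<in> S \<Longrightarrow> surj (f a)"
      and f_cond: "\<And>a. a \<in> S \<Longrightarrow> if a = t then f a (\<pi> v) = \<pi> v + e \<and> (\<forall>x\<in>W. a \<otimes> x \<in> W \<longrightarrow> f a (\<pi> x) = \<pi> (a \<otimes> x))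
         else \<forall>x\<in>V. a \<otimes> x \<in> V \<longrightarrow> f a (\<pi> x) = \<pi> (a \<otimes> x)"
      by (drule_tac bchoice) blast
    have f_W: "f a (\<pi> x) = \<pi> (a \<otimes> x)" if "a \<in> S" "x \<in> W" "a \<otimes> x \<in> W" for a x
      using f_cond[OF that(1)] that by (auto simp: V_def split: if_splits)
    have f_V: "f s (\<pi> x) = \<pi> (s \<otimes> x)" if "x \<in> V" "s \<otimes> x \<in> V" for x
      using f_cond[OF sv(1)] that t by auto
    have f_t: "f t (\<pi> v) = \<pi> v + e" using f_cond[OF t(1)] by simp
    have f_inj: "f a x = f a y \<longleftrightarrow> x = y" if "a \<in> S" for a x y
      using f(1)[OF that] by (simp add: strict_mono_eq)
    obtain \<rho> :: "'a \<Rightarrow> real \<Rightarrow> real" where \<rho>: "\<rho> \<one> = id"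
      "\<And>g h. g \<in> carrier G \<Longrightarrow> h \<in> carrier G \<Longrightarrow> \<rho> (g \<otimes> h) = \<rho> g \<circ> \<rho> h"
      "\<And>s. s \<in> S \<Longrightarrow> \<rho> s = f s"
      "\<And>g. g \<in> carrier G \<Longrightarrow> strict_mono (\<rho> g)"
      "\<And>x. sign_map (\<lambda>g. if \<rho> g x > x then 1 else if \<rho> g x < x then - 1 else 0)"
    proof (rule free_basis_sign_map_orbit[OF basis, of f])
    qed (rule f that; assumption)+
    have \<rho>_letter: "\<rho> (a \<otimes> x) y = f a (\<rho> x y)" if "a \<in> S" "x \<in> carrier G" for a x y
      using \<rho>(2)[of a x] \<rho>(3) that S by auto
    define x\<^sub>0 where "x\<^sub>0 = \<pi> \<one>"
    \<comment> \<open>The orbit of the base point \<open>\<pi> \<one>\<close> reproduces the ranks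
      on \<open>W\<close>. Injectivity of \<open>f a\<close> supplies the backward half of the
      equivalence along an edge.\<close>
    have orbit_W: "\<rho> w x\<^sub>0 = \<pi> w" if "w \<in> W" for w
    proof (rule cayley_connectedD[OF W(3), where P = "\<lambda>w. \<rho> w x\<^sub>0 = \<pi> w"])
      show "\<rho> \<one> x\<^sub>0 = \<pi> \<one>" by (simp add: \<rho>(1) x\<^sub>0_def)
      show "\<rho> x x\<^sub>0 = \<pi> x \<longleftrightarrow> \<rho> (a \<otimes> x) x\<^sub>0 = \<pi> (a \<otimes> x)"
        if "a \<in> S" "x \<in> W" "a \<otimes> x \<in> W" for a x
        using f_W[OF that] \<rho>_letter[of a x x\<^sub>0] that Wc f_inj[of a] by auto
    qed (rule that)
    have orbit_v: "\<rho> v x\<^sub>0 = \<pi> v"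
      using sv(3)
    proof
      assume v: "v = s \<otimes> u"
      then show ?thesis
        using \<rho>_letter[OF sv(1) uc] f_V[of u] orbit_W[OF u(1)] u(1) by (simp add: V_def)
    next
      assume uv: "u = s \<otimes> v"
      then have "f s (\<rho> v x\<^sub>0) = f s (\<pi> v)"
        using \<rho>_letter[OF sv(1,2)] f_V[of v] orbit_W[OF u(1)] u(1) by (simp add: V_def)
      then show ?thesis using f_inj[OF sv(1)] by blast
    qed
    \<comment> \<open>Since \<open>\<rho> v\<close> is increasing and sends the base point to
      \<open>\<pi> v\<close>, the side of the base point on which \<open>\<rho> h\<close> puts it is
      the sign of \<open>e\<close>.\<close>
    have "\<rho> v (\<rho> h x\<^sub>0) = \<pi> v + e"
      using \<rho>(2)[OF sv(2) h(1)] h(2) \<rho>_letter[OF t(1) sv(2), of x\<^sub>0] orbit_v f_t by simp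
    then have "\<rho> h x\<^sub>0 > x\<^sub>0 \<longleftrightarrow> e > 0" "\<rho> h x\<^sub>0 < x\<^sub>0 \<longleftrightarrow> e < 0"
      using strict_mono_less[OF \<rho>(4)[OF sv(2)], of x\<^sub>0 "\<rho> h x\<^sub>0"]
        strict_mono_less[OF \<rho>(4)[OF sv(2)], of "\<rho> h x\<^sub>0" x\<^sub>0] orbit_v by simp_all
    moreover have "(if \<rho> a x\<^sub>0 > x\<^sub>0 then 1 else if \<rho> a x\<^sub>0 < x\<^sub>0 then - 1 else 0) = \<phi> a" if "a \<in> A" for a
    proof -
      have a: "a \<in> W" "a \<in> carrier G" using that W Wc by auto
      have "x\<^sub>0 \<le> \<rho> a x\<^sub>0 \<longleftrightarrow> \<phi> a \<ge> 0" "\<rho> a x\<^sub>0 \<le> x\<^sub>0 \<longleftrightarrow> \<phi> a \<le> 0"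
        using \<pi>[of \<one> a] \<pi>[of a \<one>] a Wc sign_map_inv[OF \<phi> a(2)] orbit_W[OF a(1)]
        by (auto simp: V_def x\<^sub>0_def)
      then show ?thesis using sign_map_values[OF \<phi> a(2)] by auto
    qed
    ultimately show ?thesis
      using \<rho>(5)[of x\<^sub>0] e
      by (intro exI[of _ "\<lambda>g. if \<rho> g x\<^sub>0 > x\<^sub>0 then 1 else if \<rho> g x\<^sub>0 < x\<^sub>0 then - 1 else 0"]) auto
  qed
  show ?thesis using step[of "1/2"] step[of "- 1/2"] that[OF h(1)] by auto
qed

end

section \<open>The topology of the spaces of left-preorders\<close>

lemma closedin_Collect_ball:
  assumes "\<And>i. i \<in> I \<Longrightarrow> closedin T {x \<in> topspace T. P i x}"
  shows "closedin T {x \<in> topspace T. \<forall>i\<in>I. P i x}"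
proof -
  have "topspace T - {x \<in> topspace T. \<forall>i\<in>I. P i x} =
      (\<Union>i\<in>I. topspace T - {x \<in> topspace T. P i x})" by blast
  moreover have "openin T (\<Union>i\<in>I. topspace T - {x \<in> topspace T. P i x})"
    using assms by (intro openin_Union) (auto simp: closedin_def)
  ultimately show ?thesis by (simp only: closedin_def) blast
qed

lemma topspace_sign_topology: "topspace (sign_topology G) = (\<Pi>\<^sub>E g\<in>carrier G. {1, - 1, 0})"
  by (simp add: sign_topology_def)

lemma compact_space_sign_topology: "compact_space (sign_topology G)"
  unfolding sign_topology_def compact_space_product_topology
  by (simp add: compact_space_discrete_topology)

lemma cylinder_clopen:
  assumes "g \<in> carrier G"
  shows "openin (sign_topology G) {\<phi> \<in> topspace (sign_topology G). P (\<phi> g)}"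
    and "closedin (sign_topology G) {\<phi> \<in> topspace (sign_topology G). P (\<phi> g)}"
proof -
  have cont: "continuous_map (sign_topology G) (discrete_topology {1, - 1, 0}) (\<lambda>\<phi>. \<phi> g)"
    unfolding sign_topology_def using assms by (rule continuous_map_product_projection)
  have eq: "{\<phi> \<in> topspace (sign_topology G). P (\<phi> g)} =
      {\<phi> \<in> topspace (sign_topology G). \<phi> g \<in> {i \<in> {1, - 1, 0}. P i}}"
    using assms by (auto simp: topspace_sign_topology PiE_iff)
  show "openin (sign_topology G) {\<phi> \<in> topspace (sign_topology G). P (\<phi> g)}"
    unfolding eq by (rule openin_continuous_map_preimage[OF cont]) auto
  show "closedin (sign_topology G) {\<phi> \<in> topspace (sign_topology G). P (\<phi> g)}"
    unfolding eq by (rule closedin_continuous_map_preimage[OF cont]) auto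
qed

text \<open>A basic neighbourhood constrains only finitely many coordinates, so another member of
  \<open>K\<close> that agrees there lies in it.\<close>

lemma no_isolated_elements_sign_subspace:
  assumes "\<And>\<phi> A. \<phi> \<in> K \<Longrightarrow> finite A \<Longrightarrow> A \<subseteq> carrier G \<Longrightarrow> \<exists>\<psi>\<in>K. \<psi> \<noteq> \<phi> \<and> (\<forall>a\<in>A. \<psi> a = \<phi> a)"
    and K: "K \<subseteq> topspace (sign_topology G)"
  shows "no_isolated_elements (subtopology (sign_topology G) K)"
  unfolding no_isolated_elements_def
proof
  assume "\<exists>\<phi>\<in>topspace (subtopology (sign_topology G) K). openin (subtopology (sign_topology G) K) {\<phi>}"
  then obtain \<phi> O' where \<phi>: "\<phi> \<in> K" and O': "openin (sign_topology G) O'" "{\<phi>} = O' \<inter> K"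
    by (auto simp: openin_subtopology)
  have "\<phi> \<in> O'" using O'(2) by blast
  with O'(1) have "\<exists>U. finite {g \<in> carrier G. U g \<noteq> topspace (discrete_topology {1, - 1, 0 :: int})} \<and>
      (\<forall>g\<in>carrier G. openin (discrete_topology {1, - 1, 0}) (U g)) \<and>
      \<phi> \<in> Pi\<^sub>E (carrier G) U \<and> Pi\<^sub>E (carrier G) U \<subseteq> O'"
    unfolding sign_topology_def openin_product_topology_alt by (elim bspec)
  then obtain U where U: "finite {g \<in> carrier G. U g \<noteq> {1, - 1, 0}}"
    "\<phi> \<in> Pi\<^sub>E (carrier G) U" "Pi\<^sub>E (carrier G) U \<subseteq> O'"
    unfolding topspace_discrete_topology by (elim exE conjE)
  obtain \<psi> where \<psi>: "\<psi> \<in> K" "\<psi> \<noteq> \<phi>" "\<forall>a\<in>{g \<in> carrier G. U g \<noteq> {1, - 1, 0}}. \<psi> a = \<phi> a"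
    using assms(1)[OF \<phi> U(1)] by blast
  have "\<psi> \<in> Pi\<^sub>E (carrier G) U"
  proof (rule PiE_I)
    show "\<psi> g \<in> U g" if "g \<in> carrier G" for g
    proof (cases "U g = {1, - 1, 0}")
      case True
      then show ?thesis using \<psi>(1) K that by (auto simp: topspace_sign_topology PiE_iff)
    next
      case False
      then show ?thesis using \<psi>(3) U(2) that by (metis (mono_tags, lifting) PiE_mem mem_Collect_eq)
    qed
    show "\<psi> g = undefined" if "g \<notin> carrier G" for g
      using \<psi>(1) K that by (auto simp: topspace_sign_topology PiE_iff extensional_def)
  qed
  then show False using U(3) O'(2) \<psi>(1,2) by blast
qed

text \<open>The separating sequence enumerates the cylinders that fix one coordinate to one value;
  countability of the carrier makes this a sequence.\<close>

lemma is_cantor_set_sign_subspace: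
  assumes cnt: "countable (carrier G)" "carrier G \<noteq> {}" and K: "closedin (sign_topology G) K" "K \<noteq> {}"
    and perfect: "no_isolated_elements (subtopology (sign_topology G) K)"
  shows "is_cantor_set (subtopology (sign_topology G) K)"
proof -
  let ?T = "subtopology (sign_topology G) K"
  have top: "topspace ?T = K" using closedin_subset[OF K(1)] by auto
  define p where "p = from_nat_into (carrier G \<times> {1, - 1, 0 :: int})"
  have range_p: "range p = carrier G \<times> {1, - 1, 0}"
    unfolding p_def using cnt by (intro range_from_nat_into) auto
  define U where "U n = {\<phi> \<in> topspace (sign_topology G). \<phi> (fst (p n)) = snd (p n)} \<inter> K" for n
  have p_carrier: "fst (p n) \<in> carrier G" for n using range_p by (metis mem_Times_iff rangeI)
  show ?thesis
  proof (rule clopen_separated_imp_cantor_set[of ?T U])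
    show "compact_space ?T"
      using closedin_compact_space[OF compact_space_sign_topology K(1)]
      by (rule compact_space_subtopology)
    show "topspace ?T \<noteq> {}" using top K(2) by simp
    show "no_isolated_elements ?T" by (rule perfect)
    show "openin ?T (U n)" for n
      unfolding U_def by (rule openin_subtopology_Int[OF cylinder_clopen(1)[OF p_carrier]])
    show "closedin ?T (U n)" for n
      unfolding U_def closedin_subtopology
      by (rule exI, rule conjI, rule cylinder_clopen(2)[OF p_carrier[of n], of "\<lambda>i. i = snd (p n)"],
          rule refl)
    show "\<exists>n. (\<phi> \<in> U n) \<noteq> (\<psi> \<in> U n)"
      if \<phi>\<psi>: "\<phi> \<in> topspace ?T" "\<psi> \<in> topspace ?T" "\<phi> \<noteq> \<psi>" for \<phi> \<psi>
    proof -
      have in_top: "\<phi> \<in> topspace (sign_topology G)" "\<psi> \<in> topspace (sign_topology G)"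
        using \<phi>\<psi> by auto
      then obtain g where g: "g \<in> carrier G" "\<phi> g \<noteq> \<psi> g"
        using \<phi>\<psi>(3) unfolding topspace_sign_topology by (meson PiE_ext)
      then have "(g, \<phi> g) \<in> range p"
        unfolding range_p using in_top(1) by (auto simp: topspace_sign_topology PiE_iff)
      then obtain n where "p n = (g, \<phi> g)" by (metis imageE)
      then have "\<phi> \<in> U n" "\<psi> \<notin> U n" using \<phi>\<psi> in_top g top by (auto simp: U_def)
      then show ?thesis by blast
    qed
  qed
qed

context group
begin

section \<open>Left-preorders correspond to nonzero sign maps\<close>

lemma sign_map_cong:
  assumes "\<And>g. g \<in> carrier G \<Longrightarrow> \<phi> g = \<psi> g"
  shows "sign_map \<phi> \<longleftrightarrow> sign_map \<psi>"
  using assms by (simp add: sign_map_def)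

lemma sign_map_restrict: "sign_map (restrict \<phi> (carrier G)) \<longleftrightarrow> sign_map \<phi>"
  by (rule sign_map_cong) simp

lemma closedin_sign_maps:
  "closedin (sign_topology G) {\<phi> \<in> topspace (sign_topology G). sign_map \<phi>}"
proof -
  let ?X = "topspace (sign_topology G)"
  have inv: "closedin (sign_topology G) {\<phi> \<in> ?X. \<phi> (inv g) = - \<phi> g}" if g: "g \<in> carrier G" for g
  proof -
    \<comment> \<open>The condition links two coordinates; splitting by the value at
      \<open>g\<close> makes it a finite union of intersections of cylinders.\<close>
    have "{\<phi> \<in> ?X. \<phi> (inv g) = - \<phi> g} =
        (\<Union>i\<in>{1, - 1, 0}. {\<phi> \<in> ?X. \<phi> g = i} \<inter> {\<phi> \<in> ?X. \<phi> (inv g) = - i})"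
      using g by (auto simp: topspace_sign_topology PiE_iff)
    also have "closedin (sign_topology G) \<dots>"
    proof (rule closedin_Union)
      fix B assume "B \<in> (\<lambda>i. {\<phi> \<in> ?X. \<phi> g = i} \<inter> {\<phi> \<in> ?X. \<phi> (inv g) = - i}) ` {1, - 1, 0}"
      then obtain i where B: "B = {\<phi> \<in> ?X. \<phi> g = i} \<inter> {\<phi> \<in> ?X. \<phi> (inv g) = - i}" by blast
      show "closedin (sign_topology G) B"
        unfolding B by (intro closedin_Int cylinder_clopen inv_closed g)
    qed simp
    finally show ?thesis .
  qed
  have mult: "closedin (sign_topology G) {\<phi> \<in> ?X. \<phi> g \<ge> 0 \<longrightarrow> \<phi> h \<ge> 0 \<longrightarrow> \<phi> (g \<otimes> h) \<ge> 0}"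
    if g: "g \<in> carrier G" and h: "h \<in> carrier G" for g h
  proof -
    have "{\<phi> \<in> ?X. \<phi> g \<ge> 0 \<longrightarrow> \<phi> h \<ge> 0 \<longrightarrow> \<phi> (g \<otimes> h) \<ge> 0} =
        {\<phi> \<in> ?X. \<not> \<phi> g \<ge> 0} \<union> ({\<phi> \<in> ?X. \<not> \<phi> h \<ge> 0} \<union> {\<phi> \<in> ?X. \<phi> (g \<otimes> h) \<ge> 0})"
      by blast
    then show ?thesis
      using cylinder_clopen(2)[OF g, of "\<lambda>i. \<not> i \<ge> 0"] cylinder_clopen(2)[OF h, of "\<lambda>i. \<not> i \<ge> 0"]
        cylinder_clopen(2)[OF m_closed[OF g h], of "\<lambda>i. i \<ge> 0"]
      by (auto intro!: closedin_Un)
  qed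
  have "{\<phi> \<in> ?X. sign_map \<phi>} = {\<phi> \<in> ?X. \<forall>g\<in>carrier G. \<phi> (inv g) = - \<phi> g} \<inter>
      {\<phi> \<in> ?X. \<forall>g\<in>carrier G. \<forall>h\<in>carrier G. \<phi> g \<ge> 0 \<longrightarrow> \<phi> h \<ge> 0 \<longrightarrow> \<phi> (g \<otimes> h) \<ge> 0}"
    by (auto simp: sign_map_def topspace_sign_topology PiE_iff)
  also have "closedin (sign_topology G) \<dots>"
    by (intro closedin_Int closedin_Collect_ball inv mult)
  finally show ?thesis .
qed

text \<open>By left-invariance every comparison of \<open>x\<close> with \<open>y\<close> is one of
  \<open>\<one>\<close> with \<open>inv x \<otimes> y\<close>, so the preorder is encoded by its
  signs. A zero map would relate all pairs.\<close>

lemma left_preorder_preorder_map: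
  assumes r: "left_preorder G r"
  shows "preorder_map G r \<in> topspace (sign_topology G)" "sign_map (preorder_map G r)"
    "\<exists>g\<in>carrier G. preorder_map G r g \<noteq> 0"
    "preorder_kernel G r = {g \<in> carrier G. preorder_map G r g = 0}"
proof -
  let ?\<phi> = "preorder_map G r"
  have inv_rel: "(x, y) \<in> r \<longleftrightarrow> (\<one>, inv x \<otimes> y) \<in> r" if "x \<in> carrier G" "y \<in> carrier G" for x y
  proof
    assume "(x, y) \<in> r"
    then have "(inv x \<otimes> x, inv x \<otimes> y) \<in> r" using r that unfolding left_preorder_def by blast
    then show "(\<one>, inv x \<otimes> y) \<in> r" using that by simp
  next
    assume "(\<one>, inv x \<otimes> y) \<in> r"
    then have "(x \<otimes> \<one>, x \<otimes> (inv x \<otimes> y)) \<in> r" using r that unfolding left_preorder_def by blast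
    then show "(x, y) \<in> r" using that by (simp add: inv_cancel)
  qed
  have rel_one: "(g, \<one>) \<in> r \<longleftrightarrow> (\<one>, inv g) \<in> r" if "g \<in> carrier G" for g
    using inv_rel[of g \<one>] that by simp
  have total: "(\<one>, g) \<in> r \<or> (g, \<one>) \<in> r" if "g \<in> carrier G" for g
    using r that unfolding left_preorder_def total_on_def refl_on_def by (metis one_closed)
  have eq: "?\<phi> g = (if (g, \<one>) \<notin> r then 1 else if (\<one>, g) \<notin> r then - 1 else 0)"
    if g: "g \<in> carrier G" for g
    using total[OF g] rel_one[OF g] rel_one[of "inv g"] g
    by (auto simp: preorder_map_def positive_cone_def preorder_kernel_def)
  have nonneg: "?\<phi> g \<ge> 0 \<longleftrightarrow> (\<one>, g) \<in> r" if g: "g \<in> carrier G" for g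
    using eq[OF g] total[OF g] by auto
  show "?\<phi> \<in> topspace (sign_topology G)"
    using eq by (auto simp: topspace_sign_topology PiE_iff) (simp add: preorder_map_def)
  show "preorder_kernel G r = {g \<in> carrier G. ?\<phi> g = 0}"
    using eq by (auto simp: preorder_kernel_def split: if_splits)
  show "sign_map ?\<phi>"
    unfolding sign_map_def
  proof (intro conjI ballI impI)
    fix g assume g: "g \<in> carrier G"
    show "?\<phi> g \<in> {1, - 1, 0}" using eq[OF g] by simp
    show "?\<phi> (inv g) = - ?\<phi> g"
      using eq[OF g] eq[of "inv g"] g total[OF g] rel_one[OF g] rel_one[of "inv g"] by auto
    fix h assume h: "h \<in> carrier G" and "?\<phi> g \<ge> 0" "?\<phi> h \<ge> 0"
    then have "(\<one>, g) \<in> r" "(\<one>, h) \<in> r" using nonneg g by auto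
    moreover from this have "(g, g \<otimes> h) \<in> r" using inv_rel[of g "g \<otimes> h"] g h by (simp add: inv_cancel)
    ultimately have "(\<one>, g \<otimes> h) \<in> r" using r unfolding left_preorder_def by (meson transD)
    then show "?\<phi> (g \<otimes> h) \<ge> 0" using nonneg g h by simp
  qed
  show "\<exists>g\<in>carrier G. ?\<phi> g \<noteq> 0"
  proof (rule ccontr)
    assume "\<not> ?thesis"
    then have "(\<one>, g) \<in> r" if "g \<in> carrier G" for g using nonneg[OF that] that by simp
    then have "(x, y) \<in> r" if "x \<in> carrier G" "y \<in> carrier G" for x y
      using inv_rel[OF that] that by simp
    then have "carrier G \<times> carrier G \<subseteq> r" by blast
    then show False using r unfolding left_preorder_def by (metis subset_antisym)
  qed
qed

lemma sign_map_preorder: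
  assumes \<phi>: "\<phi> \<in> extensional (carrier G)" "sign_map \<phi>" "\<exists>g\<in>carrier G. \<phi> g \<noteq> 0"
  obtains r where "left_preorder G r" "preorder_map G r = \<phi>"
proof -
  define r where "r = {(x, y) \<in> carrier G \<times> carrier G. \<phi> (inv x \<otimes> y) \<ge> 0}"
  have swap: "\<phi> (inv y \<otimes> x) = - \<phi> (inv x \<otimes> y)" if "x \<in> carrier G" "y \<in> carrier G" for x y
    using sign_map_swap[OF \<phi>(2)] that .
  have "left_preorder G r"
    unfolding left_preorder_def
  proof (intro conjI ballI impI)
    show "r \<subseteq> carrier G \<times> carrier G" by (auto simp: r_def)
    show "total_on (carrier G) r"
      unfolding total_on_def
    proof (intro ballI impI)
      fix x y assume "x \<in> carrier G" "y \<in> carrier G"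
      then show "(x, y) \<in> r \<or> (y, x) \<in> r" using swap[of x y] by (auto simp: r_def)
    qed
    show "trans r"
    proof (rule transI)
      fix x y z assume "(x, y) \<in> r" "(y, z) \<in> r"
      then show "(x, z) \<in> r" using sign_map_trans[OF \<phi>(2), of x y z] by (simp add: r_def)
    qed
    show "refl_on (carrier G) r" using sign_map_one[OF \<phi>(2)] by (auto simp: refl_on_def r_def)
    show "(g \<otimes> x, g \<otimes> y) \<in> r"
      if "g \<in> carrier G" "x \<in> carrier G" "y \<in> carrier G" "(x, y) \<in> r" for g x y
      using that by (simp add: r_def inv_mult_group m_assoc inv_cancel)
    obtain g where g: "g \<in> carrier G" "\<phi> g \<noteq> 0" using \<phi>(3) by blast
    then have "(\<one>, g) \<notin> r \<or> (g, \<one>) \<notin> r" using sign_map_inv[OF \<phi>(2) g(1)] by (auto simp: r_def)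
    then show "r \<noteq> carrier G \<times> carrier G" using g by auto
  qed
  moreover have "preorder_map G r = \<phi>"
  proof
    fix g
    show "preorder_map G r g = \<phi> g"
    proof (cases "g \<in> carrier G")
      case True
      then show ?thesis
        using sign_map_values[OF \<phi>(2) True] sign_map_inv[OF \<phi>(2) True]
        by (auto simp: preorder_map_def positive_cone_def preorder_kernel_def r_def)
    next
      case False
      then show ?thesis using \<phi>(1) by (simp add: preorder_map_def extensional_def)
    qed
  qed
  ultimately show ?thesis by (rule that)
qed

text \<open>Both spaces are now described by conditions on coordinates alone. In the relative case,
  non-triviality of the preorder becomes properness of \<open>C\<close>.\<close>

lemma preorder_map_image:
  "preorder_map G ` {r. left_preorder G r} =
     {\<phi> \<in> topspace (sign_topology G). sign_map \<phi>} - {\<phi>. \<forall>g\<in>carrier G. \<phi> g = 0}"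
  "preorder_map G ` {r. left_preorder_relative_to G C r} =
     {\<phi> \<in> topspace (sign_topology G). sign_map \<phi>}
       \<inter> {\<phi>. {g \<in> carrier G. \<phi> g = 0} = C \<and> C \<noteq> carrier G}"
proof -
  have ext: "\<phi> \<in> extensional (carrier G)" if "\<phi> \<in> topspace (sign_topology G)" for \<phi>
    using that by (simp add: topspace_sign_topology PiE_iff)
  show "preorder_map G ` {r. left_preorder G r} =
     {\<phi> \<in> topspace (sign_topology G). sign_map \<phi>} - {\<phi>. \<forall>g\<in>carrier G. \<phi> g = 0}" (is "_ = ?R")
  proof
    show "preorder_map G ` {r. left_preorder G r} \<subseteq> ?R"
      using left_preorder_preorder_map by blast
    show "?R \<subseteq> preorder_map G ` {r. left_preorder G r}"
      using ext sign_map_preorder by (smt (verit) DiffE image_eqI mem_Collect_eq subsetI)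
  qed
  show "preorder_map G ` {r. left_preorder_relative_to G C r} =
     {\<phi> \<in> topspace (sign_topology G). sign_map \<phi>}
       \<inter> {\<phi>. {g \<in> carrier G. \<phi> g = 0} = C \<and> C \<noteq> carrier G}" (is "_ = ?R")
  proof
    show "preorder_map G ` {r. left_preorder_relative_to G C r} \<subseteq> ?R"
    proof
      fix \<phi> assume "\<phi> \<in> preorder_map G ` {r. left_preorder_relative_to G C r}"
      then obtain r where r: "left_preorder G r" "preorder_kernel G r = C" "\<phi> = preorder_map G r"
        by (auto simp: left_preorder_relative_to_def)
      then show "\<phi> \<in> ?R" using left_preorder_preorder_map[OF r(1)] by auto
    qed
    show "?R \<subseteq> preorder_map G ` {r. left_preorder_relative_to G C r}"
    proof
      fix \<phi> assume \<phi>: "\<phi> \<in> ?R"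
      then obtain r where r: "left_preorder G r" "preorder_map G r = \<phi>"
        using sign_map_preorder[of \<phi>] ext by blast
      then have "preorder_kernel G r = C" using left_preorder_preorder_map(4)[OF r(1)] \<phi> by simp
      then show "\<phi> \<in> preorder_map G ` {r. left_preorder_relative_to G C r}"
        using r by (auto simp: left_preorder_relative_to_def)
    qed
  qed
qed

section \<open>Absence of isolated elements\<close>

lemma no_isolated_PO:
  assumes basis: "free_basis G S" and nc: "\<not> comm_group G"
  shows "no_isolated_elements (PO G)"
  unfolding PO_def preorder_map_image
proof (rule no_isolated_elements_sign_subspace)
  fix \<phi> A assume \<phi>: "\<phi> \<in> {\<phi> \<in> topspace (sign_topology G). sign_map \<phi>} - {\<phi>. \<forall>g\<in>carrier G. \<phi> g = 0}"
    and A: "finite A" "A \<subseteq> carrier G"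
  then obtain g where g: "g \<in> carrier G" "\<phi> g \<noteq> 0" and s: "sign_map \<phi>" by blast
  obtain h \<phi>\<^sub>1 \<phi>\<^sub>2 where h: "h \<in> carrier G" "sign_map \<phi>\<^sub>1" "sign_map \<phi>\<^sub>2"
    "\<And>a. a \<in> A \<Longrightarrow> \<phi>\<^sub>1 a = \<phi> a" "\<And>a. a \<in> A \<Longrightarrow> \<phi>\<^sub>2 a = \<phi> a" "\<phi>\<^sub>1 h = 1" "\<phi>\<^sub>2 h = - 1"
    using sign_map_perturbation[OF basis nc s g A] by metis
  \<comment> \<open>Take \<open>\<phi>\<^sub>2\<close> if \<open>\<phi> h = 1\<close> and
    \<open>\<phi>\<^sub>1\<close> otherwise. The nonzero value at \<open>h\<close> keeps the result
    a genuine left-preorder.\<close>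
  then obtain \<psi> where \<psi>: "sign_map \<psi>" "\<And>a. a \<in> A \<Longrightarrow> \<psi> a = \<phi> a" "\<psi> h \<noteq> \<phi> h" "\<psi> h \<noteq> 0"
    by (cases "\<phi> h = 1") force+
  show "\<exists>\<psi>\<in>{\<phi> \<in> topspace (sign_topology G). sign_map \<phi>} - {\<phi>. \<forall>g\<in>carrier G. \<phi> g = 0}.
      \<psi> \<noteq> \<phi> \<and> (\<forall>a\<in>A. \<psi> a = \<phi> a)"
  proof (intro bexI[of _ "restrict \<psi> (carrier G)"] conjI ballI)
    show "restrict \<psi> (carrier G) \<noteq> \<phi>" using \<psi>(3) h(1) by (metis restrict_apply')
    show "restrict \<psi> (carrier G) a = \<phi> a" if "a \<in> A" for a using \<psi>(2) A that by auto
    show "restrict \<psi> (carrier G) \<in>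
      {\<phi> \<in> topspace (sign_topology G). sign_map \<phi>} - {\<phi>. \<forall>g\<in>carrier G. \<phi> g = 0}"
      using \<psi>(1,4) h(1) sign_map_values[OF \<psi>(1)]
      by (auto simp: sign_map_restrict topspace_sign_topology)
  qed
qed auto

lemma no_isolated_PO_rel:
  assumes basis: "free_basis G S" and nc: "\<not> comm_group G"
    and C: "finitely_generated_subgroup C G"
  shows "no_isolated_elements (PO_rel G C)"
  unfolding PO_rel_def preorder_map_image
proof (rule no_isolated_elements_sign_subspace)
  fix \<phi> A assume \<phi>: "\<phi> \<in> {\<phi> \<in> topspace (sign_topology G). sign_map \<phi>}
       \<inter> {\<phi>. {g \<in> carrier G. \<phi> g = 0} = C \<and> C \<noteq> carrier G}"
    and A: "finite A" "A \<subseteq> carrier G"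
  then obtain g where g: "g \<in> carrier G" "\<phi> g \<noteq> 0" and s: "sign_map \<phi>" by auto
  obtain D where D: "finite D" "D \<subseteq> carrier G" "C = generate G D"
    using C by (auto simp: finitely_generated_subgroup_def)
  have "D \<subseteq> C" unfolding D(3) by (rule subsetI) (rule generate.incl)
  moreover have ker: "{g \<in> carrier G. \<phi> g = 0} = C" "C \<noteq> carrier G" using \<phi> by simp_all
  ultimately have D0: "\<phi> d = 0" if "d \<in> D" for d using that by auto
  obtain h \<phi>\<^sub>1 \<phi>\<^sub>2 where h: "h \<in> carrier G" "sign_map \<phi>\<^sub>1" "sign_map \<phi>\<^sub>2"
    "\<And>a. a \<in> A \<union> D \<Longrightarrow> \<phi>\<^sub>1 a = \<phi> a" "\<And>a. a \<in> A \<union> D \<Longrightarrow> \<phi>\<^sub>2 a = \<phi> a" "\<phi>\<^sub>1 h = 1" "\<phi>\<^sub>2 h = - 1"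
    \<comment> \<open>Including the generators \<open>D\<close> in the finite set forces the
      perturbed map to vanish on all of \<open>C\<close>.\<close>
    using sign_map_perturbation[OF basis nc s g, of "A \<union> D"] A D by (metis finite_Un le_sup_iff)
  then obtain \<psi> where \<psi>: "sign_map \<psi>" "\<And>a. a \<in> A \<union> D \<Longrightarrow> \<psi> a = \<phi> a" "\<psi> h \<noteq> \<phi> h" "\<psi> h \<noteq> 0"
    by (cases "\<phi> h = 1") force+
  have \<psi>C: "\<psi> c = 0" if "c \<in> C" for c
    using sign_map_kernel_generate[OF \<psi>(1) D(2)] \<psi>(2) D0 that D(3) by auto
  \<comment> \<open>The kernel of \<open>\<xi>\<close> is the intersection of those of
    \<open>\<psi>\<close> and \<open>\<phi>\<close>, which is \<open>C\<close>. As
    \<open>\<psi> h\<close> is nonzero, the refinement keeps the change at \<open>h\<close>.\<close>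
  define \<xi> where "\<xi> = (\<lambda>g\<in>carrier G. if \<psi> g = 0 then \<phi> g else \<psi> g)"
  have \<xi>: "sign_map \<xi>" unfolding \<xi>_def sign_map_restrict by (rule sign_map_lex[OF \<psi>(1) s])
  show "\<exists>\<psi>\<in>{\<phi> \<in> topspace (sign_topology G). sign_map \<phi>}
       \<inter> {\<phi>. {g \<in> carrier G. \<phi> g = 0} = C \<and> C \<noteq> carrier G}.
      \<psi> \<noteq> \<phi> \<and> (\<forall>a\<in>A. \<psi> a = \<phi> a)"
  proof (intro bexI[of _ \<xi>] conjI ballI)
    have "\<xi> h \<noteq> \<phi> h" using \<psi>(3,4) h(1) by (simp add: \<xi>_def)
    then show "\<xi> \<noteq> \<phi>" by blast
    show "\<xi> a = \<phi> a" if "a \<in> A" for a using \<psi>(2) A that by (auto simp: \<xi>_def)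
    have "{g \<in> carrier G. \<xi> g = 0} = C" using ker \<psi>C by (auto simp: \<xi>_def)
    moreover have "\<xi> \<in> topspace (sign_topology G)"
      using sign_map_values[OF \<xi>] by (auto simp: topspace_sign_topology PiE_iff) (simp add: \<xi>_def)
    ultimately show "\<xi> \<in> {\<phi> \<in> topspace (sign_topology G). sign_map \<phi>}
       \<inter> {\<phi>. {g \<in> carrier G. \<phi> g = 0} = C \<and> C \<noteq> carrier G}"
      using \<xi> ker(2) by simp
  qed
qed auto

section \<open>The Cantor set statements\<close>

lemma countable_free_group:
  assumes "free_basis G S" "countable S"
  shows "countable (carrier G)"
proof -
  have "reduced_words S \<subseteq> lists (UNIV \<times> S)" by (auto simp: reduced_words_def)
  moreover have "countable (lists ((UNIV :: bool set) \<times> S))" using assms(2) by simp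
  ultimately have "countable (reduced_words S)" using countable_subset by blast
  then show ?thesis using assms(1) unfolding free_basis_def bij_betw_def by (metis countable_image)
qed

text \<open>Prescribing the kernel exactly is a clopen condition on each coordinate, so the space is
  closed; relative convexity of \<open>C\<close> makes it nonempty.\<close>

lemma is_cantor_set_PO_rel:
  assumes basis: "free_basis G S" "countable S" and nc: "\<not> comm_group G"
    and C: "finitely_generated_subgroup C G" "left_relatively_convex G C"
  shows "is_cantor_set (PO_rel G C)"
  unfolding PO_rel_def
proof (rule is_cantor_set_sign_subspace)
  show "countable (carrier G)" "carrier G \<noteq> {}" using countable_free_group[OF basis] by auto
  have CG: "C \<subseteq> carrier G" "C \<noteq> carrier G"
    using C(2) by (auto simp: left_relatively_convex_def subgroup.subset)
  have "closedin (sign_topology G) {\<phi> \<in> topspace (sign_topology G). \<forall>g\<in>carrier G. \<phi> g = 0 \<longleftrightarrow> g \<in> C}"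
    by (intro closedin_Collect_ball cylinder_clopen)
  then have "closedin (sign_topology G)
      ({\<phi> \<in> topspace (sign_topology G). sign_map \<phi>} \<inter>
       {\<phi> \<in> topspace (sign_topology G). \<forall>g\<in>carrier G. \<phi> g = 0 \<longleftrightarrow> g \<in> C})"
    by (rule closedin_Int[OF closedin_sign_maps])
  moreover have "preorder_map G ` {r. left_preorder_relative_to G C r} =
      {\<phi> \<in> topspace (sign_topology G). sign_map \<phi>} \<inter>
       {\<phi> \<in> topspace (sign_topology G). \<forall>g\<in>carrier G. \<phi> g = 0 \<longleftrightarrow> g \<in> C}"
    unfolding preorder_map_image using CG by auto
  ultimately show "closedin (sign_topology G) (preorder_map G ` {r. left_preorder_relative_to G C r})"
    by simp
  show "preorder_map G ` {r. left_preorder_relative_to G C r} \<noteq> {}"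
    using C(2) by (auto simp: left_relatively_convex_def)
  show "no_isolated_elements (subtopology (sign_topology G)
      (preorder_map G ` {r. left_preorder_relative_to G C r}))"
    using no_isolated_PO_rel[OF basis(1) nc C(1)] by (simp add: PO_rel_def)
qed

text \<open>Removing the zero map could destroy closedness. With a finite basis it does not: a sign
  map is nonzero exactly if it is nonzero at a basis element, and this is a finite union of clopen
  cylinders.\<close>

lemma is_cantor_set_PO:
  assumes basis: "free_basis G S" "finite S" and nc: "\<not> comm_group G"
  shows "is_cantor_set (PO G)"
  unfolding PO_def
proof (rule is_cantor_set_sign_subspace)
  have S: "S \<subseteq> carrier G" using basis by (simp add: free_basis_def)
  show "countable (carrier G)" "carrier G \<noteq> {}"
    using countable_free_group[OF basis(1)] basis(2) by (auto simp: countable_finite)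
  have zero: "(\<forall>g\<in>carrier G. \<phi> g = 0) \<longleftrightarrow> (\<forall>s\<in>S. \<phi> s = 0)" if \<phi>: "sign_map \<phi>" for \<phi>
  proof
    assume z: "\<forall>s\<in>S. \<phi> s = 0"
    have "\<phi> g = 0" if "g \<in> carrier G" for g
      using basis(1) that
    proof (induction g rule: free_basis_induct)
      case one
      show ?case by (rule sign_map_one[OF \<phi>])
    next
      case (letter s x)
      then show ?case using sign_map_mult_zero[OF \<phi>, of s x] z S by blast
    next
      case (inv_letter s x)
      then have "s \<in> carrier G" using S by blast
      then show ?case
        using sign_map_mult_zero[OF \<phi>, of "inv s" x] sign_map_inv[OF \<phi>, of s] z inv_letter by simp
    qed
    then show "\<forall>g\<in>carrier G. \<phi> g = 0" by blast
  qed (use S in blast)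
  have "closedin (sign_topology G) (\<Union>s\<in>S. {\<phi> \<in> topspace (sign_topology G). \<phi> s \<noteq> 0})"
    using basis(2) S by (intro closedin_Union) (auto intro: cylinder_clopen(2))
  then have "closedin (sign_topology G) ({\<phi> \<in> topspace (sign_topology G). sign_map \<phi>} \<inter>
      (\<Union>s\<in>S. {\<phi> \<in> topspace (sign_topology G). \<phi> s \<noteq> 0}))"
    by (rule closedin_Int[OF closedin_sign_maps])
  moreover have "preorder_map G ` {r. left_preorder G r} =
      {\<phi> \<in> topspace (sign_topology G). sign_map \<phi>} \<inter>
      (\<Union>s\<in>S. {\<phi> \<in> topspace (sign_topology G). \<phi> s \<noteq> 0})"
    unfolding preorder_map_image using zero by auto
  ultimately show "closedin (sign_topology G) (preorder_map G ` {r. left_preorder G r})" by simp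
  \<comment> \<open>For nonemptiness every generator acts as translation by 1; the orbit of 0 then
    gives the sign of the exponent sum.\<close>
  obtain \<rho> :: "'a \<Rightarrow> real \<Rightarrow> real" where \<rho>: "\<And>s. s \<in> S \<Longrightarrow> \<rho> s = (\<lambda>x. x + 1)"
    "\<And>x. sign_map (\<lambda>g. if \<rho> g x > x then 1 else if \<rho> g x < x then - 1 else 0)"
  proof (rule free_basis_sign_map_orbit[OF basis(1), of "\<lambda>_ x. x + 1"])
    show "strict_mono (\<lambda>x::real. x + 1)" by (simp add: strict_mono_def)
    show "surj (\<lambda>x::real. x + 1)" by (rule surjI[of _ "\<lambda>x. x - 1"]) simp
  qed (use that in blast)
  define \<phi> :: "'a \<Rightarrow> int" where "\<phi> = (\<lambda>g\<in>carrier G. if \<rho> g 0 > 0 then 1 else if \<rho> g 0 < 0 then - 1 else 0)"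
  obtain s where s: "s \<in> S" using free_basis_nonempty[OF basis(1) nc] by blast
  have "\<phi> s = 1" using \<rho>(1)[OF s] s S by (auto simp: \<phi>_def)
  moreover have "sign_map \<phi>" unfolding \<phi>_def sign_map_restrict by (rule \<rho>(2))
  moreover have "\<phi> \<in> topspace (sign_topology G)" by (auto simp: \<phi>_def topspace_sign_topology)
  ultimately show "preorder_map G ` {r. left_preorder G r} \<noteq> {}"
    unfolding preorder_map_image using s S by force
  show "no_isolated_elements (subtopology (sign_topology G) (preorder_map G ` {r. left_preorder G r}))"
    using no_isolated_PO[OF basis(1) nc] by (simp add: PO_def)
qed

end

theorem corollary4p11:
  fixes F :: "('a, 'b) monoid_scheme"
  assumes "free_group F" and "\<not> comm_group F"
  shows "((\<forall>C. finitely_generated_subgroup C F \<and> left_relatively_convex F C \<longrightarrow>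
             no_isolated_elements (PO_rel F C)) \<and>
          (countable_free_rank F \<longrightarrow>
             (\<forall>C. finitely_generated_subgroup C F \<and> left_relatively_convex F C \<longrightarrow>
                is_cantor_set (PO_rel F C)))) \<and>
         (no_isolated_elements (PO F) \<and>
          (finite_free_rank F \<longrightarrow> is_cantor_set (PO F)))"
proof (intro conjI impI allI)
  interpret F: group F using assms(1) by (simp add: free_group_def)
  obtain S where S: "free_basis F S" using assms(1) by (auto simp: free_group_def)
  show "no_isolated_elements (PO_rel F C)"
    if "finitely_generated_subgroup C F \<and> left_relatively_convex F C" for C
    using F.no_isolated_PO_rel[OF S assms(2)] that by blast
  show "is_cantor_set (PO_rel F C)" if "countable_free_rank F"
    and "finitely_generated_subgroup C F \<and> left_relatively_convex F C" for C
    using F.is_cantor_set_PO_rel assms(2) that unfolding countable_free_rank_def by blast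
  show "no_isolated_elements (PO F)" by (rule F.no_isolated_PO[OF S assms(2)])
  show "is_cantor_set (PO F)" if "finite_free_rank F"
    using F.is_cantor_set_PO assms(2) that unfolding finite_free_rank_def by blast
qed

end
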